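(* Let $F$ be a field and let $A$ be a finite-dimensional simple $F$-algebra that is not a division algebra. Then $A$ is two-sided zero product determined if and only if $A$ is separable.
   Context: $F$ is an arbitrary field; an algebra means an associative $F$-algebra with unity $1$; $A\otimes A$ is the tensor product over $F$. An algebra $A$ is two-sided zero product determined (2-zpd) if every bilinear functional $\varphi:A\times A\to F$ with the property that for all $x,y\in A$, $xy=yx=0$ implies $\varphi(x,y)=0$, is of the form $\varphi(x,y)=\tau_1(xy)+\tau_2(yx)$ (for all $x,y\in A$) for some linear functionals $\tau_1,\tau_2$ on $A$. An algebra $A$ is separable if $A\otimes A$ contains an element $\sum_i p_i\otimes q_i$ (finite sum) such that $\sum_i p_iq_i=1$ and $\sum_i xp_i\otimes q_i=\sum_i p_i\otimes q_ix$ for every $x\in A$. (Equivalently, $A$ is the direct product of finitely many matrix algebras $M_n(D)$, where $n\ge 1$ and $D$ is a finite-dimensional division algebra whose center is a finite separable field extension of $F$.) *)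

theory Defs
  imports Complex_Main "HOL-Library.Poly_Mapping"
begin

locale unital_algebra = vector_space scale
  for scale :: "'f::field \<Rightarrow> 'a::ring_1 \<Rightarrow> 'a" +
  assumes scale_mult_left: "scale c x * y = scale c (x * y)"
    and scale_mult_right: "x * scale c y = scale c (x * y)"

locale finite_dimensional_algebra = unital_algebra +
  assumes finite_dimensional: "\<exists>B. finite_dimensional_vector_space scale B"

definition (in unital_algebra) two_sided_ideal :: "'a set \<Rightarrow> bool" where
  "two_sided_ideal I \<longleftrightarrow> subspace I \<and> (\<forall>x\<in>I. \<forall>a. a * x \<in> I \<and> x * a \<in> I)"

text \<open>In both locales below the algebra is nonzero because of \<open>0 \<noteq> 1\<close> in class \<open>ring_1\<close>.\<close>

locale simple_algebra = unital_algebra +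
  assumes two_sided_ideal_trivial: "two_sided_ideal I \<Longrightarrow> I = {0} \<or> I = UNIV"

locale division_algebra = unital_algebra scale
  for scale :: "'f::field \<Rightarrow> 'a::ring_1 \<Rightarrow> 'a" +
  assumes ex_inverse: "(x::'a) \<noteq> 0 \<Longrightarrow> \<exists>y. x * y = 1 \<and> y * x = 1"


text \<open>
  The tensor square of the algebra over its base field is the quotient of the free vector space
  on pairs, realised as finitely supported functions \<open>'a \<times> 'a \<Rightarrow>\<^sub>0 'f\<close>, by the subspace
  spanned by the bilinearity relations; its elements are the cosets of this subspace.
\<close>

definition free_scale :: "'f::field \<Rightarrow> ('b \<Rightarrow>\<^sub>0 'f) \<Rightarrow> ('b \<Rightarrow>\<^sub>0 'f)" where
  "free_scale c u = Poly_Mapping.map ((*) c) u"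

lemma lookup_free_scale: "Poly_Mapping.lookup (free_scale c u) k = c * Poly_Mapping.lookup u k"
  by (simp add: free_scale_def Poly_Mapping.map.rep_eq when_def)

interpretation free: vector_space free_scale
  by unfold_locales (auto intro!: poly_mapping_eqI simp: lookup_free_scale lookup_add algebra_simps)

context unital_algebra
begin

definition tensor_relations :: "('a \<times> 'a \<Rightarrow>\<^sub>0 'f) set" where
  "tensor_relations =
     {Poly_Mapping.single (x + x', y) 1 - Poly_Mapping.single (x, y) 1
        - Poly_Mapping.single (x', y) 1 | x x' y. True} \<union>
     {Poly_Mapping.single (x, y + y') 1 - Poly_Mapping.single (x, y) 1
        - Poly_Mapping.single (x, y') 1 | x y y'. True} \<union>
     {Poly_Mapping.single (scale c x, y) 1
        - free_scale c (Poly_Mapping.single (x, y) 1) | c x y. True} \<union>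
     {Poly_Mapping.single (x, scale c y) 1
        - free_scale c (Poly_Mapping.single (x, y) 1) | c x y. True}"

definition tensor_class :: "('a \<times> 'a \<Rightarrow>\<^sub>0 'f) \<Rightarrow> ('a \<times> 'a \<Rightarrow>\<^sub>0 'f) set" where
  "tensor_class u = {v. v - u \<in> free.span tensor_relations}"

lemma tensor_class_eq_iff:
  "tensor_class u = tensor_class v \<longleftrightarrow> u - v \<in> free.span tensor_relations"
proof
  assume "tensor_class u = tensor_class v"
  moreover have "u \<in> tensor_class u"
    by (simp add: tensor_class_def free.span_zero)
  ultimately show "u - v \<in> free.span tensor_relations"
    by (simp add: tensor_class_def)
next
  assume uv: "u - v \<in> free.span tensor_relations"
  have "w - u \<in> free.span tensor_relations \<longleftrightarrow> w - v \<in> free.span tensor_relations" for w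
    using free.span_add[OF _ uv, of "w - u"] free.span_diff[OF _ uv, of "w - v"] by auto
  then show "tensor_class u = tensor_class v"
    by (simp add: tensor_class_def)
qed

text \<open>
  The element \<open>p 0 \<otimes> q 0 + \<dots> + p (n - 1) \<otimes> q (n - 1)\<close> of the tensor square; addition of cosets
  is addition of representatives.
\<close>

definition tensor_sum :: "nat \<Rightarrow> (nat \<Rightarrow> 'a) \<Rightarrow> (nat \<Rightarrow> 'a) \<Rightarrow> ('a \<times> 'a \<Rightarrow>\<^sub>0 'f) set" where
  "tensor_sum n p q = tensor_class (\<Sum>i<n. Poly_Mapping.single (p i, q i) 1)"

definition separable :: bool where
  "separable \<longleftrightarrow>
     (\<exists>n p q. (\<Sum>i<n. p i * q i) = 1 \<and>
        (\<forall>x. tensor_sum n (\<lambda>i. x * p i) q = tensor_sum n p (\<lambda>i. q i * x)))"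

definition bilinear_functional :: "('a \<Rightarrow> 'a \<Rightarrow> 'f) \<Rightarrow> bool" where
  "bilinear_functional \<phi> \<longleftrightarrow>
     (\<forall>x. Vector_Spaces.linear scale (*) (\<lambda>y. \<phi> x y)) \<and>
     (\<forall>y. Vector_Spaces.linear scale (*) (\<lambda>x. \<phi> x y))"

definition two_sided_zero_product_determined :: bool where
  "two_sided_zero_product_determined \<longleftrightarrow>
     (\<forall>\<phi>. bilinear_functional \<phi> \<longrightarrow>
        (\<forall>x y. x * y = 0 \<and> y * x = 0 \<longrightarrow> \<phi> x y = 0) \<longrightarrow>
        (\<exists>\<tau>\<^sub>1 \<tau>\<^sub>2. Vector_Spaces.linear scale (*) \<tau>\<^sub>1 \<and> Vector_Spaces.linear scale (*) \<tau>\<^sub>2 \<and>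
           (\<forall>x y. \<phi> x y = \<tau>\<^sub>1 (x * y) + \<tau>\<^sub>2 (y * x))))"

end

end

theory Submission
  imports Defs "HOL-Library.Function_Algebras"
begin

text \<open>
  If \<open>A\<close> is separable: a finite-dimensional simple algebra with a zero divisor is generated by
  idempotents. For bilinear \<open>\<phi>\<close> vanishing on pairs with \<open>x y = y x = 0\<close>, let \<open>t\<close> be the induced
  functional on \<open>A \<otimes> A\<close>. For an idempotent \<open>e\<close> with complement \<open>f\<close> and \<open>w\<close> in the kernel
  \<open>\<Omega>\<close> of multiplication, \<open>e w - w e = e w f - f w e\<close> is killed by \<open>t\<close>, so \<open>t (a w) = t (w a)\<close> for
  all \<open>a\<close>; substituting a separability idempotent into this identity yields \<open>\<tau>\<^sub>1\<close> and \<open>\<tau>\<^sub>2\<close>.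

  Conversely, let \<open>t\<close> be a nonzero trace functional and \<open>D\<close> a derivation of \<open>A\<close>. Von Neumann
  regularity shows that \<open>t (D x y)\<close> vanishes whenever \<open>x y = y x = 0\<close>, hence it equals
  \<open>\<tau> (x y - y x)\<close> for some functional \<open>\<tau>\<close>, which by nondegeneracy of \<open>t\<close> means that \<open>D\<close> is inner.
  Every finite-dimensional bimodule is filtered with simple quotients that are isomorphic to \<open>A\<close> or
  on which some central element acts differently from left and right; in both cases derivations into
  the quotient are inner. So \<open>a \<mapsto> a \<otimes> 1 - 1 \<otimes> a\<close> is inner as a derivation into \<open>\<Omega>\<close>, which is
  separability.
\<close>

section \<open>Multiplication operators, idempotents and regularity\<close>

locale finite_simple_algebra =
  simple_algebra scale + finite_dimensional_vector_space scale Basis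
  for scale :: "'f::field \<Rightarrow> 'a::ring_1 \<Rightarrow> 'a" and Basis :: "'a set"

context finite_dimensional_vector_space
begin

text \<open>A basis of \<open>V\<close> extending \<open>{y}\<close> has an image in which
  \<open>Q y\<close> contributes nothing to the span. This strict drop drives the minimal-rank
  arguments below.\<close>

lemma dim_image_less:
  assumes Q: "Vector_Spaces.linear scale scale Q" and V: "subspace V" and y: "y \<in> V" "y \<noteq> 0" "Q y = 0"
  shows "dim (Q ` V) < dim V"
proof -
  interpret Q: Vector_Spaces.linear scale scale Q by (rule Q)
  have "independent {y}" using y(2) by simp
  then obtain B where B: "{y} \<subseteq> B" "B \<subseteq> V" "independent B" "V \<subseteq> span B"
    using maximal_independent_subset_extend[of "{y}" V] y(1) by blast
  have fin: "finite B" using B(3) finiteI_independent by blast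
  have "Q b \<in> span (Q ` (B - {y}))" if "b \<in> B" for b
    using that y(3) by (cases "b = y") (auto intro: span_base span_zero)
  then have "Q ` B \<subseteq> span (Q ` (B - {y}))" by blast
  then have "Q ` V \<subseteq> span (Q ` (B - {y}))"
    by (metis B(4) Q.span_image image_mono order_trans span_minimal subspace_span)
  then have "dim (Q ` V) \<le> card (Q ` (B - {y}))"
    using fin by (intro dim_le_card) auto
  also have "\<dots> \<le> card (B - {y})" using fin by (intro card_image_le) auto
  also have "\<dots> < card B" using fin B(1) by (intro psubset_card_mono) auto
  also have "card B = dim V" using B by (intro basis_card_eq_dim) auto
  finally show ?thesis .
qed

end

context unital_algebra
begin

definition center :: "'a set" where
  "center = {z. \<forall>a. a * z = z * a}"

text \<open>A list represents an element of the enveloping algebra of \<open>A\<close>; different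
  lists may give the same operator.\<close>

definition act :: "('a \<times> 'a) list \<Rightarrow> 'a \<Rightarrow> 'a" where
  "act s x = (\<Sum>(p, q)\<leftarrow>s. p * x * q)"

lemma act_simps [simp]:
  "act [] x = 0" "act ((p, q) # s) x = p * x * q + act s x" "act (s @ t) x = act s x + act t x"
  by (simp_all add: act_def)

lemma act_map_left: "act (map (\<lambda>(p, q). (a * p, q)) s) x = a * act s x"
  by (induction s) (auto simp: algebra_simps)

lemma act_map_right: "act (map (\<lambda>(p, q). (p, q * a)) s) x = act s x * a"
  by (induction s) (auto simp: algebra_simps)

lemma act_compose: "\<exists>u. \<forall>x. act u x = act s (act t x)"
proof (induction s)
  case Nil
  show ?case by (intro exI[of _ "[]"]) simp
next
  case (Cons pq s)
  obtain p q where pq: "pq = (p, q)" by fastforce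
  from Cons obtain u where "\<forall>x. act u x = act s (act t x)" by blast
  then show ?case
    by (intro exI[of _ "map (\<lambda>(p', q'). (p * p', q')) (map (\<lambda>(p', q'). (p', q' * q)) t) @ u"])
      (simp add: pq act_map_left act_map_right mult.assoc del: map_map)
qed

lemma linear_act: "Vector_Spaces.linear scale scale (act s)"
proof unfold_locales
  fix x y c
  show "act s (x + y) = act s x + act s y"
    by (induction s) (auto simp: algebra_simps)
  show "act s (scale c x) = scale c (act s x)"
    by (induction s) (auto simp: scale_right_distrib scale_mult_left scale_mult_right)
qed

end

context simple_algebra
begin

text \<open>The values at \<open>y\<close> of all multiplication operators form the two-sided ideal
  generated by \<open>y\<close>, which simplicity forces to be everything.\<close>

lemma act_eq_one:
  assumes "y \<noteq> 0"
  shows "\<exists>s. act s y = 1"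
proof -
  let ?I = "range (\<lambda>s. act s y)"
  have "two_sided_ideal ?I"
    unfolding two_sided_ideal_def
  proof (intro conjI subspaceI ballI allI)
    show "0 \<in> ?I" by (rule range_eqI[of _ _ "[]"]) simp
  next
    fix x x' assume "x \<in> ?I" "x' \<in> ?I"
    then obtain s s' where "x = act s y" "x' = act s' y" by blast
    then have "x + x' = act (s @ s') y" by simp
    then show "x + x' \<in> ?I" by blast
  next
    fix x c assume "x \<in> ?I"
    then obtain s where "x = act s y" by blast
    then have "scale c x = act (map (\<lambda>(p, q). (scale c 1 * p, q)) s) y"
      by (simp only: act_map_left) (simp add: scale_mult_left)
    then show "scale c x \<in> ?I" by blast
  next
    fix x a assume "x \<in> ?I"
    then obtain s where "x = act s y" by blast
    then have "a * x = act (map (\<lambda>(p, q). (a * p, q)) s) y"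
      "x * a = act (map (\<lambda>(p, q). (p, q * a)) s) y"
      by (simp_all add: act_map_left act_map_right)
    then show "a * x \<in> ?I" "x * a \<in> ?I" by blast+
  qed
  moreover have "y \<in> ?I" by (rule range_eqI[of _ _ "[(1, 1)]"]) simp
  ultimately have "?I = UNIV" using two_sided_ideal_trivial assms by blast
  then have "1 \<in> ?I" by simp
  then show ?thesis by (metis imageE)
qed

lemma act_eq:
  assumes "y \<noteq> 0"
  shows "\<exists>s. act s y = x"
  by (metis act_eq_one[OF assms] act_map_left mult.right_neutral)

end

context finite_simple_algebra
begin

lemma dim_image_act_le: "dim (act s ` V) \<le> dim V"
proof -
  interpret finite_dimensional_vector_space_pair scale Basis scale Basis
    by unfold_locales
  show ?thesis using linear_act by (rule dim_image_le)
qed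

text \<open>A nonzero multiplication operator of minimal rank with \<open>1\<close> in its range: composing it with
  \<open>x \<mapsto> a x - x a\<close>, which kills \<open>1\<close>, lowers the rank and hence gives \<open>0\<close>.\<close>

lemma ex_central_act:
  "\<exists>s x0. act s x0 = 1 \<and> (\<forall>x. act s x \<in> center)"
proof -
  define Q where "Q s \<longleftrightarrow> (\<exists>x. act s x \<noteq> 0)" for s
  have "Q [(1, 1)]" by (auto simp: Q_def intro!: exI[of _ 1])
  then obtain s where s: "Q s" and min: "\<And>t. Q t \<Longrightarrow> dim (range (act s)) \<le> dim (range (act t))"
    using ex_has_least_nat[of Q _ "\<lambda>s. dim (range (act s))"] by blast
  obtain x0 where x0: "act s x0 \<noteq> 0" using s by (auto simp: Q_def)
  \<comment> \<open>Composing with \<open>t\<close> normalises the value at \<open>x0\<close>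
    without raising the rank, so the minimum is still attained.\<close>
  then obtain t where t: "act t (act s x0) = 1" using act_eq_one by blast
  obtain u where u: "\<And>x. act u x = act t (act s x)" using act_compose by blast
  have ur: "range (act u) = act t ` range (act s)" by (auto simp: u)
  have sub: "subspace (range (act u))"
    using linear_act by (intro module_hom.subspace_image) (auto simp: Vector_Spaces.linear_def)
  have "dim (range (act u)) \<le> dim (range (act s))"
    unfolding ur by (rule dim_image_act_le)
  moreover have "Q u" using t u by (auto simp: Q_def intro!: exI[of _ x0])
  ultimately have minu: "dim (range (act u)) \<le> dim (range (act v))" if "Q v" for v
    using min[OF that] by linarith
  have "act u x \<in> center" for x
  proof (rule ccontr)
    assume "act u x \<notin> center"
    then obtain a where a: "a * act u x \<noteq> act u x * a" by (auto simp: center_def)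
    let ?c = "[(a, 1), (-1, a)]"
    obtain v where v: "\<And>x. act v x = act ?c (act u x)" using act_compose by blast
    have "range (act v) = act ?c ` range (act u)" by (auto simp: v)
    moreover have "dim (act ?c ` range (act u)) < dim (range (act u))"
      using linear_act sub
    proof (rule dim_image_less)
      show "1 \<in> range (act u)" using t u by (metis rangeI)
    qed auto
    moreover have "Q v" unfolding Q_def using a by (intro exI[of _ x]) (simp add: v)
    ultimately show False using minu by fastforce
  qed
  then show ?thesis using t u by metis
qed

text \<open>Central-valued operators serve as coordinate functions of \<open>A\<close> over its
  center. Among the remainders left by partial expansions, one of least rank must vanish.\<close>

lemma ex_central_expansion:
  "\<exists>es. (\<forall>(s, b)\<in>set es. \<forall>x. act s x \<in> center) \<and> (\<forall>x. (\<Sum>(s, b)\<leftarrow>es. act s x * b) = x)"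
proof -
  obtain e x0 where e: "act e x0 = 1" "\<And>x. act e x \<in> center" using ex_central_act by blast
  define W where "W es t \<longleftrightarrow> (\<forall>(s, b)\<in>set es. \<forall>x. act s x \<in> center) \<and>
    (\<forall>x. act t x = x - (\<Sum>(s, b)\<leftarrow>es. act s x * b))" for es t
  have "W [] [(1, 1)]" by (simp add: W_def)
  then obtain t where "\<exists>es. W es t" and
    min: "\<And>u. \<exists>es. W es u \<Longrightarrow> dim (range (act t)) \<le> dim (range (act u))"
    using ex_has_least_nat[of "\<lambda>t. \<exists>es. W es t" _ "\<lambda>t. dim (range (act t))"] by blast
  then obtain es where es: "W es t" by blast
  have "act t x = 0" for x
  proof (rule ccontr)
    let ?y = "act t x"
    assume y: "?y \<noteq> 0"
    \<comment> \<open>\<open>s\<close> carries \<open>?y\<close> to the point where \<open>e\<close>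
      takes the value 1, so the new coefficient is 1 at \<open>?y\<close> and \<open>k\<close> kills
      \<open>?y\<close>.\<close>
    then obtain s where s: "act s ?y = x0" using act_eq by blast
    obtain v where v: "\<And>x. act v x = act e (act s x)" using act_compose by blast
    obtain w where w: "\<And>x. act w x = act v (act t x)" using act_compose by blast
    have "act ((1, 1) # map (\<lambda>(p, q). (p, q * - ?y)) v) x = x - act v x * ?y" for x
      using act_map_right[of "- ?y" v x] by simp
    then obtain k where k: "\<And>x. act k x = x - act v x * ?y" by blast
    obtain u where u: "\<And>x. act u x = act k (act t x)" using act_compose by blast
    have "W ((w, ?y) # es) u"
      using es e(2) by (auto simp: W_def u k w v algebra_simps)
    then have "dim (range (act t)) \<le> dim (range (act u))" using min by blast
    moreover have "range (act u) = act k ` range (act t)" by (auto simp: u)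
    moreover have "dim (act k ` range (act t)) < dim (range (act t))"
      using linear_act
    proof (rule dim_image_less)
      show "subspace (range (act t))"
        using linear_act by (intro module_hom.subspace_image) (auto simp: Vector_Spaces.linear_def)
      show "act k ?y = 0" unfolding k by (simp add: v s e(1))
    qed (use y in auto)
    ultimately show False by simp
  qed
  then show ?thesis using es unfolding W_def by (intro exI[of _ es]) auto
qed

section \<open>Right ideals, idempotents and von Neumann regularity\<close>

definition right_ideal :: "'a set \<Rightarrow> bool" where
  "right_ideal R \<longleftrightarrow> subspace R \<and> (\<forall>r\<in>R. \<forall>a. r * a \<in> R)"

lemma right_ideal_image_mult:
  assumes "right_ideal R"
  shows "right_ideal ((*) y ` R)"
  unfolding right_ideal_def
proof (intro conjI ballI allI subspaceI)
  show "0 \<in> (*) y ` R"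
    using assms subspace_0 unfolding right_ideal_def by (metis image_eqI mult_zero_right)
next
  fix x x' assume "x \<in> (*) y ` R" "x' \<in> (*) y ` R"
  then show "x + x' \<in> (*) y ` R"
    using assms unfolding right_ideal_def by (auto simp: distrib_left[symmetric] intro: subspace_add)
next
  fix c x assume "x \<in> (*) y ` R"
  then show "scale c x \<in> (*) y ` R"
    using assms unfolding right_ideal_def by (auto simp: scale_mult_right[symmetric] intro: subspace_scale)
next
  fix x a assume "x \<in> (*) y ` R"
  then show "x * a \<in> (*) y ` R"
    using assms unfolding right_ideal_def by (auto simp: mult.assoc)
qed

lemma right_ideal_UNIV: "right_ideal UNIV"
  by (simp add: right_ideal_def)

text \<open>Brauer's argument: a minimal right ideal \<open>S\<close> contains some \<open>r\<close>
  with \<open>r S = S\<close>. Solve \<open>r e = r\<close> in \<open>S\<close>; the annihilator of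
  \<open>r\<close> in \<open>S\<close> is zero by minimality, so \<open>e\<close> is
  idempotent.\<close>

lemma ex_idempotent_in_right_ideal:
  assumes R: "right_ideal R" "R \<noteq> {0}"
  shows "\<exists>e\<in>R. e * e = e \<and> e \<noteq> 0"
proof -
  define W where "W S \<longleftrightarrow> right_ideal S \<and> S \<noteq> {0} \<and> S \<subseteq> R" for S
  have "W R" using R by (simp add: W_def)
  then obtain S where S: "W S" and min: "\<And>T. W T \<Longrightarrow> dim S \<le> dim T"
    using ex_has_least_nat[of W _ dim] by blast
  have eqS: "T = S" if "right_ideal T" "T \<noteq> {0}" "T \<subseteq> S" for T
  proof (rule subspace_dim_equal)
    have "W T" using that S by (auto simp: W_def)
    then show "dim S \<le> dim T" by (rule min)
  qed (use that S in \<open>auto simp: W_def right_ideal_def\<close>)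
  have sub: "subspace S" and mul: "\<And>x a. x \<in> S \<Longrightarrow> x * a \<in> S"
    using S by (auto simp: W_def right_ideal_def)
  obtain y where y: "y \<in> S" "y \<noteq> 0" using S sub subspace_0 by (auto simp: W_def)
  obtain s where s: "act s y = 1" using act_eq_one y by blast
  \<comment> \<open>Otherwise \<open>y\<close> would annihilate the ideal it generates, which
    contains 1.\<close>
  have "\<exists>p. y * p * y \<noteq> 0"
  proof (rule ccontr)
    assume "\<nexists>p. y * p * y \<noteq> 0"
    then have "y * act s y = 0" by (induction s) (auto simp: distrib_left mult.assoc[symmetric])
    then show False using s y by simp
  qed
  then obtain p where p: "y * p * y \<noteq> 0" by blast
  let ?r = "y * p"
  have r: "?r \<in> S" "?r \<noteq> 0" using y mul p by auto
  have "(*) ?r ` S = S"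
  proof (rule eqS)
    show "right_ideal ((*) ?r ` S)" using S by (intro right_ideal_image_mult) (simp add: W_def)
    show "(*) ?r ` S \<noteq> {0}" using p y(1) by blast
    show "(*) ?r ` S \<subseteq> S" using r mul by blast
  qed
  then obtain e where e: "e \<in> S" "?r * e = ?r" using r(1) by (metis imageE)
  let ?T = "{x \<in> S. ?r * x = 0}"
  have "right_ideal ?T"
    unfolding right_ideal_def using sub mul
    by (auto intro!: subspaceI simp: subspace_0 subspace_add subspace_scale distrib_left
        scale_mult_right mult.assoc[symmetric])
  then have "?T = {0}" using eqS[of ?T] y(1) p by blast
  moreover have "e * e - e \<in> ?T"
    using e mul sub by (auto simp: subspace_diff right_diff_distrib mult.assoc[symmetric])
  ultimately have "e * e = e" by auto
  then show ?thesis using e r S by (auto simp: W_def intro!: bexI[of _ e])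
qed

text \<open>Take an idempotent \<open>e = y z\<close> of largest rank. If \<open>e y\<close>
  differed from \<open>y\<close>, the right ideal \<open>(1 - e) y A\<close> would supply an
  idempotent by which \<open>e\<close> can be enlarged inside \<open>y A\<close>.\<close>

lemma von_neumann_regular:
  fixes y :: 'a
  shows "\<exists>z. y * z * y = y"
proof -
  let ?R = "range ((*) y)"
  define W where "W e \<longleftrightarrow> e \<in> ?R \<and> e * e = e" for e :: 'a
  have "W 0" by (auto simp: W_def intro: range_eqI[of _ _ 0])
  moreover have "\<forall>e. W e \<longrightarrow> dim (range ((*) e)) < Suc dimension"
    by (simp add: dim_subset_UNIV less_Suc_eq_le)
  ultimately obtain e where e: "W e" and max: "\<And>f. W f \<Longrightarrow> dim (range ((*) f)) \<le> dim (range ((*) e))"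
    using ex_has_greatest_nat[of W 0 "\<lambda>e. dim (range ((*) e))"] by blast
  have ee: "e * e = e" using e by (simp add: W_def)
  obtain z where z: "e = y * z" using e by (auto simp: W_def)
  have "e * y = y"
  proof (rule ccontr)
    assume ne: "e * y \<noteq> y"
    let ?S = "(*) (1 - e) ` ?R"
    have "(1 - e) * y \<in> ?S" by (intro imageI range_eqI[of _ _ 1]) simp
    moreover have "(1 - e) * y \<noteq> 0" using ne by (simp add: left_diff_distrib)
    ultimately have "?S \<noteq> {0}" by blast
    moreover have "right_ideal ?S"
      by (intro right_ideal_image_mult right_ideal_UNIV)
    ultimately obtain f where f: "f \<in> ?S" "f * f = f" "f \<noteq> 0"
      using ex_idempotent_in_right_ideal by blast
    obtain x where x: "f = (1 - e) * (y * x)" using f(1) by blast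
    have ef: "e * f = 0" using ee by (simp add: x mult.assoc[symmetric] right_diff_distrib)
    have ff: "f = y * (x - z * y * x)" using z by (simp add: x algebra_simps)
    \<comment> \<open>Here \<open>e f = 0\<close>, while \<open>f e\<close> may be nonzero;
      subtracting it makes \<open>g\<close> an idempotent that is a left identity for both
      \<open>e\<close> and \<open>f\<close>.\<close>
    define g where "g = e + f - f * e"
    have efe: "e * (f * w) = 0" "e * (e * w) = e * w" "f * (f * w) = f * w" for w
      using ef ee f(2) by (simp_all add: mult.assoc[symmetric])
    have gg: "g * g = g" by (simp add: g_def algebra_simps ef ee f(2) efe)
    have ge: "g * e = e" by (simp add: g_def algebra_simps ef ee f(2) efe)
    have gf: "g * f = f" by (simp add: g_def algebra_simps ef ee f(2) efe)
    have "g = y * (z + (x - z * y * x) - (x - z * y * x) * e)"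
      unfolding distrib_left right_diff_distrib mult.assoc[symmetric] g_def
      using z ff by (simp add: mult.assoc right_diff_distrib)
    then have "W g" using gg by (auto simp: W_def)
    moreover have "dim (range ((*) e)) < dim (range ((*) g))"
    proof (rule dim_psubset)
      have sp: "span (range ((*) h)) = range ((*) h)" for h
        using right_ideal_image_mult[OF right_ideal_UNIV] by (simp add: right_ideal_def)
      have "range ((*) e) \<subseteq> range ((*) g)" using ge by (metis image_subset_iff mult.assoc rangeI)
      moreover have "f \<in> range ((*) g)" using gf by (metis rangeI)
      moreover have "f \<notin> range ((*) e)" using ef f(3) efe by auto
      ultimately show "span (range ((*) e)) \<subset> span (range ((*) g))" unfolding sp by blast
    qed
    ultimately show False using max by fastforce
  qed
  then show ?thesis using z by blast
qed

end

section \<open>Bimodules and their central elements\<close>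

text \<open>The axioms are restricted to a carrier \<open>C\<close> so that spaces of linear maps
  fit inside a full function type.\<close>

locale bimodule = unital_algebra scale + M: vector_space s
  for scale :: "'f::field \<Rightarrow> 'a::ring_1 \<Rightarrow> 'a" and s :: "'f \<Rightarrow> 'm::ab_group_add \<Rightarrow> 'm" +
  fixes C :: "'m set" and l :: "'a \<Rightarrow> 'm \<Rightarrow> 'm" and r :: "'m \<Rightarrow> 'a \<Rightarrow> 'm"
  assumes subspace_C: "M.subspace C"
    and l_closed: "m \<in> C \<Longrightarrow> l a m \<in> C"
    and r_closed: "m \<in> C \<Longrightarrow> r m a \<in> C"
    and l_add: "m \<in> C \<Longrightarrow> n \<in> C \<Longrightarrow> l a (m + n) = l a m + l a n"
    and r_add: "m \<in> C \<Longrightarrow> n \<in> C \<Longrightarrow> r (m + n) a = r m a + r n a"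
    and l_add_left: "m \<in> C \<Longrightarrow> l (a + b) m = l a m + l b m"
    and r_add_right: "m \<in> C \<Longrightarrow> r m (a + b) = r m a + r m b"
    and l_mult: "m \<in> C \<Longrightarrow> l (a * b) m = l a (l b m)"
    and r_mult: "m \<in> C \<Longrightarrow> r m (a * b) = r (r m a) b"
    and r_l: "m \<in> C \<Longrightarrow> r (l a m) b = l a (r m b)"
    and l_one: "m \<in> C \<Longrightarrow> l 1 m = m"
    and r_one: "m \<in> C \<Longrightarrow> r m 1 = m"
    and l_scale_left: "m \<in> C \<Longrightarrow> l (scale c a) m = s c (l a m)"
    and r_scale_right: "m \<in> C \<Longrightarrow> r m (scale c a) = s c (r m a)"
begin

lemma C_intros [simp, intro]:
  "0 \<in> C" "m \<in> C \<Longrightarrow> n \<in> C \<Longrightarrow> m + n \<in> C" "m \<in> C \<Longrightarrow> n \<in> C \<Longrightarrow> m - n \<in> C"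
  "m \<in> C \<Longrightarrow> s c m \<in> C" "m \<in> C \<Longrightarrow> l a m \<in> C" "m \<in> C \<Longrightarrow> r m a \<in> C"
  using subspace_C l_closed r_closed
  by (auto intro: M.subspace_0 M.subspace_add M.subspace_diff M.subspace_scale)

lemma l_scale: "m \<in> C \<Longrightarrow> l a (s c m) = s c (l a m)"
  by (metis C_intros(5) l_mult l_one l_scale_left mult.right_neutral scale_mult_right)

lemma r_scale: "m \<in> C \<Longrightarrow> r (s c m) a = s c (r m a)"
  by (metis C_intros(6) r_mult r_one r_scale_right mult.left_neutral scale_mult_left)

lemma l_zero [simp]: "l a 0 = 0" and r_zero [simp]: "r 0 a = 0"
  using l_add[of 0 0 a] r_add[of 0 0 a] by simp_all

lemma l_zero_left [simp]: "m \<in> C \<Longrightarrow> l 0 m = 0" and r_zero_right [simp]: "m \<in> C \<Longrightarrow> r m 0 = 0"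
  using l_add_left[of m 0 0] r_add_right[of m 0 0] by simp_all

lemma l_diff: "m \<in> C \<Longrightarrow> n \<in> C \<Longrightarrow> l a (m - n) = l a m - l a n"
  using l_add[of "m - n" n a] by (simp add: algebra_simps)

lemma r_diff: "m \<in> C \<Longrightarrow> n \<in> C \<Longrightarrow> r (m - n) a = r m a - r n a"
  using r_add[of "m - n" n a] by (simp add: algebra_simps)

lemma l_diff_left: "m \<in> C \<Longrightarrow> l (a - b) m = l a m - l b m"
  using l_add_left[of m "a - b" b] by (simp add: algebra_simps)

lemma l_minus_left: "m \<in> C \<Longrightarrow> l (- a) m = - l a m"
  using l_diff_left[of m 0 a] by simp

definition subbimodule :: "'m set \<Rightarrow> bool" where
  "subbimodule P \<longleftrightarrow> P \<subseteq> C \<and> M.subspace P \<and> (\<forall>a. \<forall>m\<in>P. l a m \<in> P \<and> r m a \<in> P)"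

lemma subbimoduleD:
  assumes "subbimodule P"
  shows "m \<in> P \<Longrightarrow> m \<in> C" "0 \<in> P" "m \<in> P \<Longrightarrow> n \<in> P \<Longrightarrow> m + n \<in> P"
    "m \<in> P \<Longrightarrow> n \<in> P \<Longrightarrow> m - n \<in> P" "m \<in> P \<Longrightarrow> - m \<in> P" "m \<in> P \<Longrightarrow> l a m \<in> P"
    "m \<in> P \<Longrightarrow> r m a \<in> P" "m \<in> P \<Longrightarrow> s c m \<in> P"
  using assms unfolding subbimodule_def
  by (auto intro: M.subspace_0 M.subspace_add M.subspace_diff M.subspace_neg M.subspace_scale)

lemma subbimodule_zero: "subbimodule {0}"
  by (auto simp: subbimodule_def)

definition mact :: "('a \<times> 'a) list \<Rightarrow> 'm \<Rightarrow> 'm" where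
  "mact u m = (\<Sum>(p, q)\<leftarrow>u. l p (r m q))"

lemma mact_simps [simp]:
  "mact [] m = 0" "mact ((p, q) # u) m = l p (r m q) + mact u m"
  "mact (u @ v) m = mact u m + mact v m"
  by (simp_all add: mact_def)

lemma mact_closed [simp, intro]: "m \<in> C \<Longrightarrow> mact u m \<in> C"
  by (induction u) auto

lemma subbimodule_mact: "subbimodule P \<Longrightarrow> m \<in> P \<Longrightarrow> mact u m \<in> P"
  by (induction u) (auto simp: subbimoduleD)

lemma mact_map_left: "m \<in> C \<Longrightarrow> mact (map (\<lambda>(p, q). (a * p, q)) u) m = l a (mact u m)"
  by (induction u) (auto simp: l_mult l_add)

lemma mact_map_right: "m \<in> C \<Longrightarrow> mact (map (\<lambda>(p, q). (p, q * a)) u) m = r (mact u m) a"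
  by (induction u) (auto simp: r_mult r_add r_l)

lemma mact_map_minus: "m \<in> C \<Longrightarrow> mact (map (\<lambda>(p, q). (- p, q)) u) m = - mact u m"
  by (induction u) (auto simp: l_minus_left)

end

locale simple_algebra_bimodule = finite_simple_algebra scale Basis + bimodule scale s C l r
  for scale :: "'f::field \<Rightarrow> 'a::ring_1 \<Rightarrow> 'a" and Basis and s :: "'f \<Rightarrow> 'm::ab_group_add \<Rightarrow> 'm"
    and C l r
begin

text \<open>The action of \<open>A \<otimes> A\<^sup>o\<^sup>p\<close>, tensored over the center, on \<open>A\<close> is faithful.\<close>

lemma mact_mem:
  assumes Q: "subbimodule Q" and m: "m \<in> C"
    and cent: "\<And>z. z \<in> center \<Longrightarrow> r m z - l z m \<in> Q"
    and act0: "\<And>x. act u x = 0"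
  shows "mact u m \<in> Q"
proof -
  note Qs = subbimoduleD[OF Q]
  obtain es where es: "\<And>e b x. (e, b) \<in> set es \<Longrightarrow> act e x \<in> center"
    "\<And>x. (\<Sum>(e, b)\<leftarrow>es. act e x * b) = x"
    using ex_central_expansion by blast
  \<comment> \<open>The right factor is expanded with central coefficients; modulo \<open>Q\<close>
    each coefficient moves across \<open>m\<close> to the left factor.\<close>
  have "l p (r m (\<Sum>(e, b)\<leftarrow>fs. act e v * b)) - (\<Sum>(e, b)\<leftarrow>fs. r (l (p * act e v) m) b) \<in> Q"
    if "set fs \<subseteq> set es" for p v fs
    using that
  proof (induction fs)
    case Nil
    then show ?case using m Qs(2) by simp
  next
    case (Cons eb fs)
    obtain e b where eb: "eb = (e, b)" by fastforce
    let ?z = "act e v"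
    have "?z \<in> center" using Cons.prems eb es(1) by auto
    then have "r (l p (r m ?z - l ?z m)) b \<in> Q" by (intro Qs(6,7) cent)
    moreover have "r (l p (r m ?z - l ?z m)) b = l p (r m (?z * b)) - r (l (p * ?z) m) b"
      using m by (simp add: l_diff r_diff l_mult r_mult r_l)
    moreover have "l p (r m (\<Sum>(e, b)\<leftarrow>fs. act e v * b)) -
        (\<Sum>(e, b)\<leftarrow>fs. r (l (p * act e v) m) b) \<in> Q"
      using Cons by simp
    ultimately have "l p (r m (?z * b)) - r (l (p * ?z) m) b +
        (l p (r m (\<Sum>(e, b)\<leftarrow>fs. act e v * b)) - (\<Sum>(e, b)\<leftarrow>fs. r (l (p * act e v) m) b)) \<in> Q"
      by (auto intro: Qs(3))
    then show ?case
      using m by (simp add: eb r_add_right l_add algebra_simps)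
  qed
  from this[of es] have 1: "l p (r m v) - (\<Sum>(e, b)\<leftarrow>es. r (l (p * act e v) m) b) \<in> Q" for p v
    by (simp add: es(2))
  have "mact u m - (\<Sum>(e, b)\<leftarrow>es. r (l (\<Sum>(p, v)\<leftarrow>u. p * act e v) m) b) \<in> Q"
  proof (induction u)
    case Nil
    have "(\<Sum>(e, b)\<leftarrow>es. r (l 0 m) b) = 0" using m by (induction es) auto
    then show ?case using Qs(2) by simp
  next
    case (Cons pv u)
    obtain p v where pv: "pv = (p, v)" by fastforce
    have "(\<Sum>(e, b)\<leftarrow>es. r (l (x e b + y e b) m) b) =
        (\<Sum>(e, b)\<leftarrow>es. r (l (x e b) m) b) + (\<Sum>(e, b)\<leftarrow>es. r (l (y e b) m) b)" for x y
      using m by (induction es) (auto simp: l_add_left r_add)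
    then show ?case
      using Qs(3)[OF 1[of p v] Cons.IH] by (simp add: pv algebra_simps)
  qed
  \<comment> \<open>Interchanging the sums expresses the left factor collected at \<open>b\<close>
    through values of \<open>act u\<close>, which are all zero.\<close>
  moreover have "(\<Sum>(p, v)\<leftarrow>u. p * act e v) = (\<Sum>(p', q')\<leftarrow>e. act u p' * q')" for e
    by (induction e)
      (auto simp: act_def distrib_left sum_list_addf sum_list_mult_const[symmetric] mult.assoc split_def)
  then have "(\<Sum>(p, v)\<leftarrow>u. p * act e v) = 0" for e
    by (simp add: act0 split_def)
  moreover have "(\<Sum>(e, b)\<leftarrow>es. r (l 0 m) b) = 0" using m by (induction es) auto
  ultimately show ?thesis by simp
qed

text \<open>The coordinate operators of the central expansion together recover \<open>m\<close>, so
  one of them, \<open>e\<close>, does not send \<open>m\<close> into \<open>Q\<close>. Since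
  \<open>act e\<close> has central values, its commutator with \<open>a\<close> is zero on
  \<open>A\<close>, and \<open>mact_mem\<close> transfers this to the bimodule.\<close>

lemma ex_central_element:
  assumes Q: "subbimodule Q" and m: "m \<in> C" "m \<notin> Q"
    and cent: "\<And>z. z \<in> center \<Longrightarrow> r m z - l z m \<in> Q"
  shows "\<exists>u. mact u m \<notin> Q \<and> (\<forall>a. l a (mact u m) - r (mact u m) a \<in> Q)"
proof -
  note Qs = subbimoduleD[OF Q]
  obtain es where es: "\<And>e b x. (e, b) \<in> set es \<Longrightarrow> act e x \<in> center"
    "\<And>x. (\<Sum>(e, b)\<leftarrow>es. act e x * b) = x"
    using ex_central_expansion by blast
  have "\<exists>(e, b)\<in>set es. mact e m \<notin> Q"
  proof (rule ccontr)
    assume "\<not> ?thesis"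
    then have all: "\<And>e b. (e, b) \<in> set es \<Longrightarrow> mact e m \<in> Q" by auto
    let ?L = "\<lambda>es. concat (map (\<lambda>(e, b). map (\<lambda>(p, q). (p, q * b)) e) es)"
    \<comment> \<open>\<open>?W\<close> encodes the expansion minus the identity, hence the zero
      operator on \<open>A\<close>.\<close>
    let ?W = "(-1, 1) # ?L es"
    have "act (?L es) x = (\<Sum>(e, b)\<leftarrow>es. act e x * b)" for x
      by (induction es) (auto simp: act_map_right)
    then have "mact ?W m \<in> Q"
      by (intro mact_mem[OF Q m(1) cent]) (auto simp: es(2))
    moreover have "mact (?L es) m \<in> Q"
      using all by (induction es) (auto simp: mact_map_right m(1) Qs(2) intro!: Qs(3,7), blast)
    ultimately have "- m \<in> Q"
      using m(1) Qs(4)[of "mact ?W m" "mact (?L es) m"] by (simp add: l_minus_left r_one l_one)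
    then show False using m(2) Qs(5) by fastforce
  qed
  then obtain e b where e: "(e, b) \<in> set es" "mact e m \<notin> Q" by blast
  have "l a (mact e m) - r (mact e m) a \<in> Q" for a
  proof -
    let ?u = "map (\<lambda>(p, q). (a * p, q)) e @ map (\<lambda>(p, q). (- p, q)) (map (\<lambda>(p, q). (p, q * a)) e)"
    have "act (map (\<lambda>(p, q). (- p, q)) w) x = - act w x" for w x
      by (induction w) auto
    then have act0: "act ?u x = 0" for x
      using es(1)[OF e(1), of x]
      by (simp add: act_map_left act_map_right center_def del: map_map)
    have "mact ?u m \<in> Q" by (intro mact_mem[OF Q m(1)] cent act0)
    then show ?thesis using m(1)
      by (simp add: mact_map_left mact_map_right mact_map_minus del: map_map)
  qed
  then show ?thesis using e(2) by blast
qed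

end

section \<open>Trace functionals\<close>

context unital_algebra
begin

lemma linear_functional_iff:
  "Vector_Spaces.linear scale (*) (f :: 'a \<Rightarrow> 'f) \<longleftrightarrow>
    (\<forall>x y. f (x + y) = f x + f y) \<and> (\<forall>c x. f (scale c x) = c * f x)"
proof -
  interpret V: vector_space "(*) :: 'f \<Rightarrow> 'f \<Rightarrow> 'f"
    by unfold_locales (auto simp: algebra_simps)
  show ?thesis
    using vector_space_axioms V.vector_space_axioms
    by (auto simp: Vector_Spaces.linear_def module_hom_def module_hom_axioms_def module_axioms
        V.module_axioms)
qed

end

context finite_simple_algebra
begin

definition trace_functional :: "('a \<Rightarrow> 'f) \<Rightarrow> bool" where
  "trace_functional t \<longleftrightarrow> Vector_Spaces.linear scale (*) t \<and> (\<forall>x y. t (x * y) = t (y * x)) \<and>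
     (\<exists>x. t x \<noteq> 0)"

text \<open>A trace functional is a nonzero element of the dual bimodule of \<open>A\<close> that
  commutes with \<open>A\<close>. The center acts there equally from both sides, so
  \<open>ex_central_element\<close> produces one from a coordinate functional.\<close>

lemma ex_trace_functional: "\<exists>t. trace_functional t"
proof -
  define C where "C = {f :: 'a \<Rightarrow> 'f. Vector_Spaces.linear scale (*) f}"
  define s where "s c f = (\<lambda>x. c * f x)" for c and f :: "'a \<Rightarrow> 'f"
  define l where "l a f = (\<lambda>x. f (x * a))" for a and f :: "'a \<Rightarrow> 'f"
  define r where "r f a = (\<lambda>x. f (a * x))" for a and f :: "'a \<Rightarrow> 'f"
  interpret S: vector_space s
    by unfold_locales (auto simp: s_def fun_eq_iff algebra_simps)
  interpret bimod: simple_algebra_bimodule scale Basis s C l r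
    by unfold_locales
      (auto simp: C_def l_def r_def s_def linear_functional_iff fun_eq_iff
        algebra_simps scale_mult_left scale_mult_right intro!: S.subspaceI)
  obtain b where b: "b \<in> Basis"
    using span_Basis span_empty by (metis UNIV_I empty_iff subsetI subset_antisym singletonD zero_neq_one)
  let ?f = "\<lambda>x. representation Basis x b"
  have fC: "?f \<in> C"
    using independent_Basis span_Basis
    by (simp add: C_def linear_functional_iff representation_add representation_scale)
  have "?f b = 1" using b independent_Basis by (simp add: representation_basis)
  then have f0: "?f \<noteq> 0" by (auto simp: fun_eq_iff intro!: exI[of _ b])
  have "\<exists>u. bimod.mact u ?f \<notin> {0} \<and> (\<forall>a. l a (bimod.mact u ?f) - r (bimod.mact u ?f) a \<in> {0})"
    using fC f0
    by (intro bimod.ex_central_element bimod.subbimodule_zero)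
      (auto simp: l_def r_def center_def)
  then obtain g where "g \<in> C" "g \<noteq> 0" "\<And>a. l a g = r g a"
    using fC by auto
  then show ?thesis
    by (intro exI[of _ g]) (auto simp: trace_functional_def C_def l_def r_def fun_eq_iff)
qed

text \<open>Cyclicity of \<open>t\<close> passes the vanishing from \<open>a\<close> to the ideal
  generated by \<open>a\<close>; for nonzero \<open>a\<close> this contains 1, and \<open>t\<close>
  would be zero.\<close>

lemma trace_nondegenerate:
  assumes t: "trace_functional t" and a: "\<And>x. t (a * x) = 0"
  shows "a = 0"
proof (rule ccontr)
  assume "a \<noteq> 0"
  then obtain u where u: "act u a = 1" using act_eq_one by blast
  have add: "t (x + y) = t x + t y" for x y
    using t by (simp add: trace_functional_def linear_functional_iff)
  have t0: "t 0 = 0" using add[of 0 0] by (metis add_cancel_right_right add_0)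
  have sw: "t (x * y) = t (y * x)" for x y using t by (simp add: trace_functional_def)
  have "t (p * a * q * x) = 0" for p q x
    using sw[of p "a * q * x"] a[of "q * x * p"] by (simp add: mult.assoc)
  then have "t (act u a * x) = 0" for x
    by (induction u) (auto simp: t0 add distrib_right)
  then show False using t u by (simp add: trace_functional_def)
qed

text \<open>By nondegeneracy, \<open>a\<close> is determined by its pairings with a basis
  \<open>u\<close>. The map \<open>F\<close> with these coordinates is injective, hence surjective,
  and preimages of the basis vectors form the dual basis \<open>v\<close>.\<close>

lemma ex_dual_bases:
  assumes t: "trace_functional t"
  shows "\<exists>(n::nat) u v. (\<forall>x. (\<Sum>i<n. scale (t (v i * x)) (u i)) = x) \<and>
    (\<forall>x. (\<Sum>i<n. scale (t (x * u i)) (v i)) = x)"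
proof -
  have tl: "t (x + y) = t x + t y" "t (scale c x) = c * t x" for x y c
    using t by (simp_all add: trace_functional_def linear_functional_iff)
  interpret T: Vector_Spaces.linear scale "(*)" t
    using t by (simp add: trace_functional_def)
  define n where "n = card Basis"
  obtain u where u: "bij_betw u {..<n} Basis"
    unfolding n_def using ex_bij_betw_nat_finite[OF finite_Basis] by (auto simp: atLeast0LessThan)
  have span: "x \<in> span (u ` {..<n})" for x
    using u span_Basis by (simp add: bij_betw_def)
  have inj: "inj_on u {..<n}" using u by (simp add: bij_betw_def)
  define F where "F a = (\<Sum>i<n. scale (t (a * u i)) (u i))" for a
  have coeff: "f j = g j" if "(\<Sum>i<n. scale (f i) (u i)) = (\<Sum>i<n. scale (g i) (u i))" "j < n" for f g j
  proof -
    have "(\<Sum>i<n. scale (f i - g i) (u i)) = 0"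
      using that(1) by (simp add: scale_left_diff_distrib sum_subtractf)
    moreover have "(\<Sum>b\<in>Basis. scale (f (the_inv_into {..<n} u b) - g (the_inv_into {..<n} u b)) b) =
        (\<Sum>i<n. scale (f i - g i) (u i))"
      by (subst sum.reindex_bij_betw[OF u, symmetric])
        (intro sum.cong, auto simp: the_inv_into_f_f[OF inj])
    moreover have "u j \<in> Basis" using u that(2) by (auto simp: bij_betw_def)
    ultimately have "f (the_inv_into {..<n} u (u j)) - g (the_inv_into {..<n} u (u j)) = 0"
      by (intro independentD[OF independent_Basis finite_Basis subset_refl,
            where u = "\<lambda>b. f (the_inv_into {..<n} u b) - g (the_inv_into {..<n} u b)"]) auto
    then show ?thesis using that(2) by (simp add: the_inv_into_f_f[OF inj])
  qed
  have lin: "Vector_Spaces.linear scale scale F"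
    by unfold_locales (auto simp: F_def tl distrib_right scale_mult_left scale_left_distrib
        sum.distrib scale_sum_right)
  have ext: "a = b" if "\<And>j. j < n \<Longrightarrow> t (a * u j) = t (b * u j)" for a b
  proof -
    have "t ((a - b) * x) = 0" for x
      using span[of x]
    proof (induction rule: span_induct_alt)
      case base
      show ?case by (simp add: T.zero)
    next
      case (step c x y)
      then show ?case using that
        by (auto simp: distrib_left scale_mult_right tl left_diff_distrib T.diff)
    qed
    then show ?thesis using trace_nondegenerate[OF t, of "a - b"] by simp
  qed
  have "inj F"
    by (intro injI ext) (auto simp: F_def dest: coeff)
  then have "surj F" using lin by (intro linear_inj_imp_surj)
  then have "\<forall>i. \<exists>v. F v = u i" by (metis surjD)
  then obtain v where v: "\<And>i. F (v i) = u i" by metis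
  have dual: "t (v i * u j) = (if i = j then 1 else 0)" if "i < n" "j < n" for i j
  proof -
    have "u i = (\<Sum>j<n. scale (if i = j then 1 else 0) (u j))"
      using that by (simp add: if_distrib[of "\<lambda>c. scale c _"] cong: if_cong)
    then show ?thesis
      using coeff[of "\<lambda>j. t (v i * u j)" "\<lambda>j. if i = j then 1 else 0" j] v[of i] that by (simp add: F_def)
  qed
  have "(\<Sum>i<n. scale (t (v i * x)) (u i)) = x" for x
    using span[of x]
  proof (induction rule: span_induct_alt)
    case base
    show ?case by (simp add: T.zero)
  next
    case (step c x y)
    then obtain k where k: "k < n" "x = u k" by auto
    have "(\<Sum>i<n. scale (t (v i * u k)) (u i)) = (\<Sum>i<n. if i = k then u i else 0)"
      using k by (intro sum.cong) (auto simp: dual)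
    also have "\<dots> = u k" using k by simp
    finally have "scale c (\<Sum>i<n. scale (t (v i * u k)) (u i)) = scale c (u k)" by simp
    then have "(\<Sum>i<n. scale (c * t (v i * u k)) (u i)) = scale c (u k)"
      by (simp add: scale_sum_right)
    then show ?case using step k
      by (simp add: distrib_left tl scale_mult_right scale_left_distrib sum.distrib)
  qed
  moreover have "(\<Sum>i<n. scale (t (x * u i)) (v i)) = x" for x
  proof (rule ext)
    fix j assume j: "j < n"
    have "t ((\<Sum>i<n. scale (t (x * u i)) (v i)) * u j) = (\<Sum>i<n. t (x * u i) * t (v i * u j))"
      by (simp add: sum_distrib_right T.sum scale_mult_left tl)
    also have "\<dots> = (\<Sum>i<n. if i = j then t (x * u i) else 0)"
      using j by (intro sum.cong) (auto simp: dual)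
    finally show "t ((\<Sum>i<n. scale (t (x * u i)) (v i)) * u j) = t (x * u j)"
      using j by simp
  qed
  ultimately show ?thesis by blast
qed

end

section \<open>Generation by idempotents and zero products\<close>

context unital_algebra
begin

lemma bilinear_functional_iff:
  "bilinear_functional \<phi> \<longleftrightarrow>
    (\<forall>x x' y. \<phi> (x + x') y = \<phi> x y + \<phi> x' y) \<and> (\<forall>c x y. \<phi> (scale c x) y = c * \<phi> x y) \<and>
    (\<forall>x y y'. \<phi> x (y + y') = \<phi> x y + \<phi> x y') \<and> (\<forall>c x y. \<phi> x (scale c y) = c * \<phi> x y)"
  by (auto simp: bilinear_functional_def linear_functional_iff)

text \<open>The linear extension \<open>F\<close> of \<open>\<phi>\<close> to the free space kills
  the bilinearity relations, so it descends to the tensor square.\<close>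

lemma bilinear_functional_tensor_sum_eq:
  assumes \<phi>: "bilinear_functional \<phi>" and eq: "tensor_sum n p q = tensor_sum n p' q'"
  shows "(\<Sum>i<n. \<phi> (p i) (q i)) = (\<Sum>i<n. \<phi> (p' i) (q' i))"
proof -
  define F where "F w = Sum_any (\<lambda>k. Poly_Mapping.lookup w k * \<phi> (fst k) (snd k))" for w
  have fin: "finite {k. Poly_Mapping.lookup w k * \<phi> (fst k) (snd k) \<noteq> 0}" for w
    by (rule finite_subset[OF _ finite_lookup[of w]]) auto
  have add: "F (w + w') = F w + F w'" for w w'
    using Sum_any.distrib[OF fin[of w] fin[of w']]
    by (simp add: F_def lookup_add distrib_right)
  then have zero: "F 0 = 0" by (metis add_cancel_right_right add_0)
  have diff: "F (w - w') = F w - F w'" for w w'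
    using add[of "w - w'" w'] by simp
  have fscale: "F (free_scale c w) = c * F w" for c w
    using Sum_any_right_distrib[OF fin[of w], of c] by (simp add: F_def lookup_free_scale mult.assoc)
  have single: "F (Poly_Mapping.single (x, y) 1) = \<phi> x y" for x y
  proof -
    have "F (Poly_Mapping.single (x, y) 1) = Sum_any (\<lambda>k. \<phi> x y when k = (x, y))"
      unfolding F_def by (rule Sum_any.cong) (auto simp: lookup_single when_def)
    then show ?thesis by simp
  qed
  have sum: "F (\<Sum>i<n. Poly_Mapping.single (p i, q i) 1) = (\<Sum>i<n. \<phi> (p i) (q i))" for n :: nat and p q
    by (induction n) (simp_all add: zero add single)
  have "F w = 0" if "w \<in> free.span tensor_relations" for w
    using that
  proof (induction rule: free.span_induct_alt)
    case base
    show ?case by (rule zero)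
  next
    case (step c x y)
    from step(1) have "F x = 0"
      using \<phi> unfolding tensor_relations_def bilinear_functional_iff
      by (auto simp: diff fscale single)
    then show ?case using step(2) by (simp add: add fscale)
  qed
  then have "F ((\<Sum>i<n. Poly_Mapping.single (p i, q i) 1) - (\<Sum>i<n. Poly_Mapping.single (p' i, q' i) 1)) = 0"
    using eq unfolding tensor_sum_def tensor_class_eq_iff by blast
  then show ?thesis by (simp add: diff sum)
qed

text \<open>The key identity says that \<open>t (a w) = t (w a)\<close> for \<open>w = x \<otimes> y - 1 \<otimes> x y\<close>, where \<open>t\<close> is the
  functional on \<open>A \<otimes> A\<close> defined by \<open>\<phi>\<close>; apply it to \<open>x \<otimes> p i \<otimes> q i y\<close> and sum over \<open>i\<close>.\<close>

lemma representation_of_separable: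
  assumes sep: separable and \<phi>: "bilinear_functional \<phi>"
    and key: "\<And>a x y. \<phi> (a * x) y - \<phi> a (x * y) = \<phi> x (y * a) - \<phi> 1 (x * y * a)"
  shows "\<exists>\<tau>\<^sub>1 \<tau>\<^sub>2. Vector_Spaces.linear scale (*) \<tau>\<^sub>1 \<and> Vector_Spaces.linear scale (*) \<tau>\<^sub>2 \<and>
           (\<forall>x y. \<phi> x y = \<tau>\<^sub>1 (x * y) + \<tau>\<^sub>2 (y * x))"
proof -
  note bi = \<phi>[unfolded bilinear_functional_iff]
  obtain n p q where one: "(\<Sum>i<n. p i * q i) = 1"
    and casimir: "\<And>x. tensor_sum n (\<lambda>i. x * p i) q = tensor_sum n p (\<lambda>i. q i * x)"
    using sep unfolding separable_def by blast
  have \<phi>_sum: "\<phi> x (\<Sum>i<n. y i) = (\<Sum>i<n. \<phi> x (y i))" for x y and n :: nat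
  proof -
    interpret L: Vector_Spaces.linear scale "(*)" "\<phi> x"
      using \<phi> by (simp add: bilinear_functional_def)
    show ?thesis by (rule L.sum)
  qed
  \<comment> \<open>\<open>\<alpha> z\<close> evaluates \<open>\<phi>\<close> on the separability
    idempotent multiplied by \<open>z\<close> on the right; this becomes
    \<open>\<tau>\<^sub>1\<close>.\<close>
  define \<alpha> where "\<alpha> z = (\<Sum>i<n. \<phi> (p i) (q i * z))" for z
  have \<alpha>: "(\<Sum>i<n. \<phi> (x * p i) (q i * y)) = \<alpha> (x * y)" for x y
  proof -
    have "bilinear_functional (\<lambda>a b. \<phi> a (b * y))"
      unfolding bilinear_functional_iff using bi by (simp add: distrib_right scale_mult_left)
    from bilinear_functional_tensor_sum_eq[OF this casimir[of x]] show ?thesis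
      by (simp add: \<alpha>_def mult.assoc)
  qed
  have "\<phi> x y = \<alpha> (x * y) + (\<phi> 1 (y * x) - \<alpha> (y * x))" for x y
  proof -
    have "(\<Sum>i<n. \<phi> (x * p i) (q i * y) - \<phi> x (p i * (q i * y))) =
        (\<Sum>i<n. \<phi> (p i) (q i * y * x) - \<phi> 1 (p i * (q i * y) * x))"
      by (intro sum.cong refl key)
    then have "\<alpha> (x * y) - \<phi> x ((\<Sum>i<n. p i * q i) * y) =
        \<alpha> (y * x) - \<phi> 1 ((\<Sum>i<n. p i * q i) * y * x)"
      by (simp add: sum_subtractf \<alpha> \<phi>_sum sum_distrib_right \<alpha>_def[of "y * x"] mult.assoc)
    then show ?thesis by (simp add: one algebra_simps)
  qed
  moreover have "Vector_Spaces.linear scale (*) \<alpha>"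
    "Vector_Spaces.linear scale (*) (\<lambda>z. \<phi> 1 z - \<alpha> z)"
    unfolding linear_functional_iff \<alpha>_def using bi
    by (auto simp: distrib_left scale_mult_right sum.distrib sum_distrib_left right_diff_distrib)
  ultimately show ?thesis by blast
qed

end

context finite_simple_algebra
begin

text \<open>In finite dimension a right inverse is two-sided, so a nonzero noninvertible
  \<open>x\<close> gives a proper right ideal \<open>x A\<close>; a nonzero idempotent in it is not
  1.\<close>

lemma ex_nontrivial_idempotent:
  assumes "\<not> division_algebra scale"
  shows "\<exists>e::'a. e * e = e \<and> e \<noteq> 0 \<and> e \<noteq> 1"
proof -
  have "\<not> division_algebra_axioms TYPE('a)"
    using assms unital_algebra_axioms by (simp add: division_algebra_def)
  then obtain x :: 'a where x: "x \<noteq> 0" "\<nexists>y. x * y = 1 \<and> y * x = 1"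
    by (auto simp: division_algebra_axioms_def)
  have no_right_inverse: "x * y \<noteq> 1" for y
  proof
    assume xy: "x * y = 1"
    have "Vector_Spaces.linear scale scale ((*) y)"
      by unfold_locales (simp_all add: distrib_left scale_mult_right)
    moreover have "inj ((*) y)"
      by (rule injI) (metis xy mult.assoc mult.left_neutral)
    ultimately have "surj ((*) y)" by (rule linear_inj_imp_surj)
    then obtain z where "y * z = 1" by (metis surjD)
    moreover have "x = z" using xy \<open>y * z = 1\<close> by (metis mult.assoc mult.left_neutral mult.right_neutral)
    ultimately show False using x(2) xy by blast
  qed
  have "range ((*) x) \<noteq> {0}" using x(1) by (metis mult.right_neutral rangeI singletonD)
  then obtain e where "e \<in> range ((*) x)" "e * e = e" "e \<noteq> 0"
    using ex_idempotent_in_right_ideal[of "range ((*) x)"] right_ideal_image_mult[OF right_ideal_UNIV]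
    by blast
  then show ?thesis using no_right_inverse by (metis imageE)
qed

text \<open>For an idempotent \<open>e\<close> with complement \<open>f\<close> every \<open>e + e x f\<close> is idempotent, and
  \<open>e A e = (e A f) (f A e)\<close> because \<open>A f A = A\<close>.\<close>

lemma generated_by_idempotents:
  assumes nd: "\<not> division_algebra scale"
    and idem: "\<And>e::'a. e * e = e \<Longrightarrow> e \<in> S"
    and add: "\<And>x y. x \<in> S \<Longrightarrow> y \<in> S \<Longrightarrow> x + y \<in> S"
    and diff: "\<And>x y. x \<in> S \<Longrightarrow> y \<in> S \<Longrightarrow> x - y \<in> S"
    and mult: "\<And>x y. x \<in> S \<Longrightarrow> y \<in> S \<Longrightarrow> x * y \<in> S"
  shows "x \<in> S"
proof -
  have off: "e * y * (1 - e) \<in> S" if e: "e * e = e" for e y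
  proof -
    have "(e + e * y * (1 - e)) * (e + e * y * (1 - e)) = e + e * y * (1 - e)"
      by (simp add: algebra_simps e) (simp add: mult.assoc[symmetric] e)
    then have "e + e * y * (1 - e) - e \<in> S" using idem e diff by blast
    then show ?thesis by simp
  qed
  have diag: "e * y * e \<in> S" if e: "e * e = e" "e \<noteq> 1" for e y
  proof -
    let ?f = "1 - e"
    have f: "?f * ?f = ?f" using e(1) by (simp add: algebra_simps)
    obtain s where s: "act s ?f = 1" using act_eq_one[of ?f] e(2) by auto
    have "e * y * act s ?f * e \<in> S"
    proof (induction s)
      case Nil
      show ?case using idem[of 0] by simp
    next
      case (Cons pq s)
      obtain p q where pq: "pq = (p, q)" by fastforce
      \<comment> \<open>Since \<open>1 - ?f\<close> is \<open>e\<close>, the second factor is an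
        off-diagonal element for the idempotent \<open>?f\<close>.\<close>
      have "(e * (y * p) * ?f) * (?f * q * (1 - ?f)) \<in> S"
        by (intro mult off e f)
      moreover have "(e * (y * p) * ?f) * (?f * q * (1 - ?f)) = e * y * (p * ?f * q) * e"
        using f by (simp add: mult.assoc) (simp add: mult.assoc[symmetric])
      ultimately show ?case using Cons add by (simp add: pq distrib_left distrib_right)
    qed
    then show ?thesis by (simp add: s)
  qed
  obtain e :: 'a where e: "e * e = e" "e \<noteq> 0" "e \<noteq> 1" using ex_nontrivial_idempotent nd by blast
  have f: "(1 - e) * (1 - e) = 1 - e" using e(1) by (simp add: algebra_simps)
  \<comment> \<open>The four Peirce components of \<open>x\<close>.\<close>
  have "e * x * e + e * x * (1 - e) + ((1 - e) * x * (1 - (1 - e)) + (1 - e) * x * (1 - e)) \<in> S"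
    using e by (intro add diag off f) simp_all
  then show ?thesis by (simp add: algebra_simps)
qed

text \<open>The elements that can be moved across the two arguments of \<open>\<phi>\<close> are
  closed under sums, differences and products. An idempotent \<open>e\<close> is among them because
  \<open>x e\<close> times \<open>(1 - e) y\<close> and \<open>x (1 - e)\<close> times
  \<open>e y\<close> vanish.\<close>

lemma zero_product_balanced:
  assumes nd: "\<not> division_algebra scale" and \<phi>: "bilinear_functional \<phi>"
    and zero: "\<And>x y. x * y = 0 \<Longrightarrow> \<phi> x y = 0"
  shows "\<phi> x y = \<phi> 1 (x * y)"
proof -
  note bi = \<phi>[unfolded bilinear_functional_iff]
  let ?S = "{a. \<forall>x y. \<phi> (x * a) y = \<phi> x (a * y)}"
  have \<phi>_diff: "\<phi> (x - x') y = \<phi> x y - \<phi> x' y" "\<phi> x (y - y') = \<phi> x y - \<phi> x y'" for x x' y y'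
    using bi by (metis add_diff_cancel_right' diff_add_cancel)+
  have "x \<in> ?S"
    using nd
  proof (rule generated_by_idempotents)
    fix e :: 'a assume e: "e * e = e"
    show "e \<in> ?S"
    proof (intro CollectI allI)
      fix x y
      have "\<phi> (x * e) (y - e * y) = 0"
        using e by (intro zero) (simp add: algebra_simps, simp add: mult.assoc[symmetric])
      moreover have "\<phi> (x - x * e) (e * y) = 0"
        using e by (intro zero) (simp add: algebra_simps, simp add: mult.assoc[symmetric])
      ultimately show "\<phi> (x * e) y = \<phi> x (e * y)" by (simp add: \<phi>_diff)
    qed
  next
    fix a b assume "a \<in> ?S" "b \<in> ?S"
    then show "a + b \<in> ?S" "a - b \<in> ?S"
      using bi by (simp_all add: distrib_left distrib_right left_diff_distrib right_diff_distrib \<phi>_diff)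
    show "a * b \<in> ?S"
      using \<open>a \<in> ?S\<close> \<open>b \<in> ?S\<close> by (simp add: mult.assoc[symmetric])
  qed
  then show ?thesis by (metis (mono_tags, lifting) mem_Collect_eq mult.left_neutral)
qed

text \<open>For idempotent \<open>a\<close> with complement \<open>f\<close>, the map \<open>(x, y) \<mapsto> \<phi> (a x) (y f)\<close> vanishes
  whenever \<open>x y = 0\<close>, the reversed product being zero automatically.\<close>

lemma two_sided_zero_product_identity:
  assumes nd: "\<not> division_algebra scale" and \<phi>: "bilinear_functional \<phi>"
    and zero: "\<And>x y. x * y = 0 \<Longrightarrow> y * x = 0 \<Longrightarrow> \<phi> x y = 0"
  shows "\<phi> (a * x) y - \<phi> a (x * y) = \<phi> x (y * a) - \<phi> 1 (x * y * a)"
proof -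
  note bi = \<phi>[unfolded bilinear_functional_iff]
  have \<phi>_diff: "\<phi> (x - x') y = \<phi> x y - \<phi> x' y" "\<phi> x (y - y') = \<phi> x y - \<phi> x y'" for x x' y y'
    using bi by (metis add_diff_cancel_right' diff_add_cancel)+
  have corner: "\<phi> (e * x) (y * (1 - e)) = \<phi> e (x * y * (1 - e))" if e: "e * e = e" for e x y
  proof -
    have "bilinear_functional (\<lambda>x y. \<phi> (e * x) (y * (1 - e)))"
      unfolding bilinear_functional_iff
      using bi by (simp add: distrib_left distrib_right scale_mult_left scale_mult_right)
    moreover have "\<phi> (e * x) (y * (1 - e)) = 0" if "x * y = 0" for x y
    proof (rule zero)
      show "e * x * (y * (1 - e)) = 0" using that by (metis mult.assoc mult_zero_left mult_zero_right)
      have "(1 - e) * e = 0" using e by (simp add: algebra_simps)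
      then show "y * (1 - e) * (e * x) = 0" by (metis mult.assoc mult_zero_left mult_zero_right)
    qed
    ultimately show ?thesis using zero_product_balanced[OF nd] by (metis (no_types, lifting) mult.right_neutral)
  qed
  let ?S = "{a. \<forall>x y. \<phi> (a * x) y - \<phi> a (x * y) = \<phi> x (y * a) - \<phi> 1 (x * y * a)}"
  have "a \<in> ?S"
    using nd
  proof (rule generated_by_idempotents)
    fix e :: 'a assume e: "e * e = e"
    then have f: "(1 - e) * (1 - e) = 1 - e" by (simp add: algebra_simps)
    show "e \<in> ?S"
    proof (intro CollectI allI)
      fix x y
      \<comment> \<open>The corner identities for \<open>e\<close> and its complement reduce both
        sides to one expression.\<close>
      have "\<phi> (e * x) y - \<phi> e (x * y) = \<phi> (e * x) (y * e) - \<phi> e (x * y * e)"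
        using corner[OF e, of x y] by (simp add: \<phi>_diff algebra_simps)
      moreover have "\<phi> x (y * e) - \<phi> 1 (x * y * e) = \<phi> (e * x) (y * e) - \<phi> e (x * y * e)"
        using corner[OF f, of x y] by (simp add: \<phi>_diff algebra_simps)
      ultimately show "\<phi> (e * x) y - \<phi> e (x * y) = \<phi> x (y * e) - \<phi> 1 (x * y * e)"
        by simp
    qed
  next
    fix a b assume ab: "a \<in> ?S" "b \<in> ?S"
    then show "a + b \<in> ?S" "a - b \<in> ?S"
      using bi by (simp_all add: distrib_left distrib_right left_diff_distrib right_diff_distrib
          \<phi>_diff algebra_simps)
    show "a * b \<in> ?S"
    proof (intro CollectI allI)
      fix x y
      have a: "\<phi> (a * x) y - \<phi> a (x * y) = \<phi> x (y * a) - \<phi> 1 (x * y * a)"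
        and b: "\<phi> (b * x) y - \<phi> b (x * y) = \<phi> x (y * b) - \<phi> 1 (x * y * b)" for x y
        using ab by auto
      \<comment> \<open>Subtracting the identity for \<open>a\<close> at \<open>b, x y\<close> from
        that at \<open>b x, y\<close> reduces the claim to the identity for \<open>b\<close> at
        \<open>x, y a\<close>.\<close>
      show "\<phi> (a * b * x) y - \<phi> (a * b) (x * y) = \<phi> x (y * (a * b)) - \<phi> 1 (x * y * (a * b))"
        using a[of "b * x" y] a[of b "x * y"] b[of x "y * a"] by (simp add: mult.assoc) algebra
    qed
  qed
  then show ?thesis by simp
qed

end

section \<open>Derivations into bimodules\<close>

text \<open>Finiteness is asked only of a spanning set for \<open>P\<close>, since the ambient
  function space may have infinite dimension.\<close>

lemma (in vector_space) dim_less_of_psubset: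
  assumes "subspace Q" "Q \<subset> P" "P \<subseteq> span S" "finite S"
  shows "dim Q < dim P"
proof -
  obtain B where B: "B \<subseteq> Q" "independent B" "Q \<subseteq> span B" "card B = dim Q"
    using basis_exists by blast
  obtain x where x: "x \<in> P" "x \<notin> Q" using assms(2) by blast
  have "span B \<subseteq> Q" using B(1) assms(1) by (rule span_minimal)
  then have xB: "x \<notin> span B" using x by blast
  then have "independent (insert x B)" using B(2) by (rule independent_insertI)
  moreover have "insert x B \<subseteq> P" using x B(1) assms(2) by blast
  ultimately obtain B' where B': "insert x B \<subseteq> B'" "B' \<subseteq> P" "independent B'" "P \<subseteq> span B'"
    using maximal_independent_subset_extend by blast
  have fin: "finite B'" using independent_span_bound[OF assms(4) B'(3)] B'(2) assms(3) by blast
  have "x \<notin> B" using xB span_base by blast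
  then have "card B < card (insert x B)"
    using B'(1) fin finite_subset by (metis card_insert_disjoint finite_insert lessI)
  also have "\<dots> \<le> card B'" using B'(1) fin by (rule card_mono[rotated])
  also have "\<dots> = dim P" using B' by (intro basis_card_eq_dim)
  finally show ?thesis using B(4) by simp
qed

context bimodule
begin

definition derivation :: "('a \<Rightarrow> 'm) \<Rightarrow> bool" where
  "derivation \<delta> \<longleftrightarrow> (\<forall>a b. \<delta> (a + b) = \<delta> a + \<delta> b) \<and> (\<forall>c a. \<delta> (scale c a) = s c (\<delta> a)) \<and>
     (\<forall>a b. \<delta> (a * b) = l a (\<delta> b) + r (\<delta> a) b)"

lemma derivation_diff_inner:
  assumes "derivation \<delta>" "range \<delta> \<subseteq> C" "p \<in> C"
  shows "derivation (\<lambda>a. \<delta> a - (l a p - r p a))"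
  using assms(1) assms(2,3)[unfolded image_subset_iff]
  unfolding derivation_def
  by (auto simp: l_add_left r_add_right l_scale_left r_scale_right M.scale_right_diff_distrib
      l_diff r_diff l_mult r_mult r_l)

lemma subbimodule_sum:
  assumes P: "subbimodule P" and Q: "subbimodule Q"
  shows "subbimodule {p + q | p q. p \<in> P \<and> q \<in> Q}"
  unfolding subbimodule_def
proof (intro conjI allI ballI)
  note Ps = subbimoduleD[OF P] and Qs = subbimoduleD[OF Q]
  show "{p + q | p q. p \<in> P \<and> q \<in> Q} \<subseteq> C" using Ps(1) Qs(1) by blast
  show "M.subspace {p + q | p q. p \<in> P \<and> q \<in> Q}"
    using P Q by (intro M.subspace_sums) (auto simp: subbimodule_def)
  fix a m assume "m \<in> {p + q | p q. p \<in> P \<and> q \<in> Q}"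
  then obtain p q where "m = p + q" "p \<in> P" "q \<in> Q" by blast
  then have "l a m = l a p + l a q" "r m a = r p a + r q a"
    "l a p \<in> P" "l a q \<in> Q" "r p a \<in> P" "r q a \<in> Q"
    by (simp_all add: l_add r_add Ps Qs)
  then show "l a m \<in> {p + q | p q. p \<in> P \<and> q \<in> Q}" "r m a \<in> {p + q | p q. p \<in> P \<and> q \<in> Q}"
    by blast+
qed

text \<open>This expresses that \<open>P / Q\<close> is a simple bimodule; quotients are avoided by
  working modulo \<open>Q\<close>.\<close>

definition maximal_in :: "'m set \<Rightarrow> 'm set \<Rightarrow> bool" where
  "maximal_in Q P \<longleftrightarrow> subbimodule Q \<and> subbimodule P \<and> Q \<subset> P \<and>
     (\<forall>R. subbimodule R \<longrightarrow> Q \<subseteq> R \<longrightarrow> R \<subseteq> P \<longrightarrow> R = Q \<or> R = P)"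

lemma maximal_inD:
  assumes "maximal_in Q P" "subbimodule R" "Q \<subseteq> R" "R \<subseteq> P" "x \<in> R" "x \<notin> Q"
  shows "R = P"
  using assms unfolding maximal_in_def by metis

lemma ex_maximal_in:
  assumes P: "subbimodule P" "P \<noteq> {0}" and S: "P \<subseteq> M.span S" "finite S"
  shows "\<exists>Q. maximal_in Q P"
proof -
  define W where "W Q \<longleftrightarrow> subbimodule Q \<and> Q \<subset> P" for Q
  have "W {0}" using P subbimodule_zero subbimoduleD(2)[OF P(1)] by (auto simp: W_def)
  moreover have "\<forall>Q. W Q \<longrightarrow> M.dim Q < M.dim P"
    using M.dim_less_of_psubset[OF _ _ S] by (auto simp: W_def subbimodule_def)
  ultimately obtain Q where Q: "W Q" and max: "\<And>R. W R \<Longrightarrow> M.dim R \<le> M.dim Q"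
    using ex_has_greatest_nat[of W "{0}" M.dim] by blast
  have "R = Q \<or> R = P" if R: "subbimodule R" "Q \<subseteq> R" "R \<subseteq> P" for R
  proof (rule ccontr)
    assume ne: "\<not> (R = Q \<or> R = P)"
    then have "M.dim R \<le> M.dim Q" using R by (intro max) (auto simp: W_def)
    moreover have "M.dim Q < M.dim R"
      using M.dim_less_of_psubset[of Q R S] Q R S ne by (auto simp: W_def subbimodule_def)
    ultimately show False by simp
  qed
  then show ?thesis using Q P by (auto simp: maximal_in_def W_def)
qed

text \<open>Commutation with a central element that acts nontrivially on \<open>P / Q\<close> is an automorphism
  of this simple bimodule; it turns any derivation into an inner one.\<close>

lemma inner_mod_of_noncentral:
  assumes max: "maximal_in Q P" and z: "z \<in> center"
    and p1: "p1 \<in> P" "l z p1 - r p1 z \<notin> Q"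
    and \<delta>: "derivation \<delta>" "range \<delta> \<subseteq> P"
  shows "\<exists>p\<in>P. \<forall>a. \<delta> a - (l a p - r p a) \<in> Q"
proof -
  have Q: "subbimodule Q" and P: "subbimodule P" and QP: "Q \<subseteq> P"
    using max by (auto simp: maximal_in_def)
  note Ps = subbimoduleD[OF P] and Qs = subbimoduleD[OF Q]
  \<comment> \<open>Centrality of \<open>z\<close> makes \<open>\<theta>\<close> a bimodule
    endomorphism.\<close>
  define \<theta> where "\<theta> m = l z m - r m z" for m
  have za: "z * a = a * z" for a using z by (simp add: center_def)
  have \<theta>C: "\<theta> m \<in> C" if "m \<in> C" for m using that by (simp add: \<theta>_def)
  have \<theta>P: "\<theta> m \<in> P" if "m \<in> P" for m using that Ps by (simp add: \<theta>_def)
  have \<theta>Q: "\<theta> m \<in> Q" if "m \<in> Q" for m using that Qs by (simp add: \<theta>_def)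
  have \<theta>_add: "\<theta> (m + n) = \<theta> m + \<theta> n" if "m \<in> C" "n \<in> C" for m n
    using that by (simp add: \<theta>_def l_add r_add)
  have \<theta>_diff: "\<theta> (m - n) = \<theta> m - \<theta> n" if "m \<in> C" "n \<in> C" for m n
    using that by (simp add: \<theta>_def l_diff r_diff)
  have \<theta>_scale: "\<theta> (s c m) = s c (\<theta> m)" if "m \<in> C" for c m
    using that by (simp add: \<theta>_def l_scale r_scale M.scale_right_diff_distrib)
  have \<theta>_l: "\<theta> (l a m) = l a (\<theta> m)" if "m \<in> C" for a m
    using that by (simp add: \<theta>_def l_mult[symmetric] za l_diff r_l)
  have \<theta>_r: "\<theta> (r m a) = r (\<theta> m) a" if "m \<in> C" for a m
    using that by (simp add: \<theta>_def r_mult[symmetric] za r_diff r_l)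
  have "subbimodule (\<theta> ` P)"
    unfolding subbimodule_def
  proof (intro conjI allI ballI M.subspaceI)
    show "\<theta> ` P \<subseteq> C" using \<theta>P Ps(1) by blast
    show "0 \<in> \<theta> ` P" using Ps(2) by (intro image_eqI[of _ _ 0]) (simp_all add: \<theta>_def)
  next
    fix x y assume "x \<in> \<theta> ` P" "y \<in> \<theta> ` P"
    then obtain p q where "p \<in> P" "q \<in> P" "x = \<theta> p" "y = \<theta> q" by blast
    then show "x + y \<in> \<theta> ` P" by (intro image_eqI[of _ _ "p + q"]) (simp_all add: \<theta>_add Ps(1,3))
  next
    fix c x assume "x \<in> \<theta> ` P"
    then obtain p where "p \<in> P" "x = \<theta> p" by blast
    then show "s c x \<in> \<theta> ` P" by (intro image_eqI[of _ _ "s c p"]) (simp_all add: \<theta>_scale Ps(1,8))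
  next
    fix a x assume "x \<in> \<theta> ` P"
    then obtain p where "p \<in> P" "x = \<theta> p" by blast
    then have "l a x = \<theta> (l a p)" "r x a = \<theta> (r p a)" "l a p \<in> P" "r p a \<in> P"
      by (simp_all add: \<theta>_l \<theta>_r Ps)
    then show "l a x \<in> \<theta> ` P" "r x a \<in> \<theta> ` P" by blast+
  qed
  then have "subbimodule {x + q | x q. x \<in> \<theta> ` P \<and> q \<in> Q}" (is "subbimodule ?R")
    using Q by (rule subbimodule_sum)
  moreover have "Q \<subseteq> ?R"
  proof
    fix q assume "q \<in> Q"
    moreover have "0 \<in> \<theta> ` P" using Ps(2) by (intro image_eqI[of _ _ 0]) (simp_all add: \<theta>_def)
    ultimately show "q \<in> ?R" by force
  qed
  moreover have "?R \<subseteq> P" using \<theta>P QP Ps(3) by blast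
  moreover have "\<theta> p1 \<in> ?R" using p1(1) Qs(2) by force
  moreover have "\<theta> p1 \<notin> Q" using p1(2) by (simp add: \<theta>_def)
  ultimately have R: "?R = P" by (rule maximal_inD[OF max])
  \<comment> \<open>\<open>\<theta>\<close> is surjective modulo \<open>Q\<close>, which yields
    \<open>p\<close>; the kernel \<open>?T\<close> modulo \<open>Q\<close> will give
    injectivity.\<close>
  have "\<delta> z \<in> ?R" unfolding R using \<delta>(2) by blast
  then obtain p q where p: "p \<in> P" and q: "q \<in> Q" and \<delta>z: "\<delta> z = \<theta> p + q" by blast
  have "subbimodule {x \<in> P. \<theta> x \<in> Q}" (is "subbimodule ?T")
    unfolding subbimodule_def
  proof (intro conjI allI ballI M.subspaceI)
    show "?T \<subseteq> C" using Ps(1) by blast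
  qed (auto simp: Ps Qs \<theta>_add \<theta>_scale \<theta>_l \<theta>_r, simp add: \<theta>_def Qs(2))
  moreover have "Q \<subseteq> ?T" using QP \<theta>Q by blast
  moreover have "?T \<subseteq> P" by blast
  moreover have "p1 \<notin> ?T" using p1 by (simp add: \<theta>_def)
  ultimately have T: "x \<in> Q" if "x \<in> P" "\<theta> x \<in> Q" for x
    using maximal_inD[OF max, of ?T x] p1(1) that by blast
  have "\<delta> a - (l a p - r p a) \<in> Q" for a
  proof -
    have \<delta>P: "\<delta> a \<in> P" for a using \<delta>(2) by blast
    then have C: "p \<in> C" "q \<in> C" "\<theta> p \<in> C" "\<And>a. \<delta> a \<in> C"
      using p q \<theta>C Ps(1) Qs(1) by blast+
    \<comment> \<open>The two Leibniz expansions of \<open>\<delta>\<close> at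
      \<open>z * a = a * z\<close> are compared.\<close>
    have "l z (\<delta> a) + r (\<delta> z) a = l a (\<delta> z) + r (\<delta> a) z"
      using \<delta>(1) za[of a] unfolding derivation_def by metis
    then have "\<theta> (\<delta> a) = l a (\<delta> z) - r (\<delta> z) a"
      unfolding \<theta>_def by (simp add: algebra_simps)
    also have "\<dots> = l a (\<theta> p) - r (\<theta> p) a + (l a q - r q a)"
      unfolding \<delta>z using C by (simp add: l_add r_add)
    also have "l a (\<theta> p) - r (\<theta> p) a = \<theta> (l a p - r p a)"
      using C by (simp add: \<theta>_diff \<theta>_l \<theta>_r)
    finally have "\<theta> (\<delta> a - (l a p - r p a)) = l a q - r q a"
      using C by (simp add: \<theta>_diff)
    moreover have "l a q - r q a \<in> Q" using q Qs by simp
    moreover have "\<delta> a - (l a p - r p a) \<in> P" by (intro Ps(4,6,7) p \<delta>P)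
    ultimately show ?thesis using T by simp
  qed
  then show ?thesis using p by blast
qed

end

context simple_algebra_bimodule
begin

text \<open>Here \<open>P / Q\<close> is generated by an element commuting with \<open>A\<close>, hence isomorphic to \<open>A\<close>.\<close>

lemma inner_mod_of_central:
  assumes inner: "\<And>D. Vector_Spaces.linear scale scale D \<Longrightarrow> (\<And>a b. D (a * b) = a * D b + D a * b) \<Longrightarrow>
      \<exists>b. \<forall>a. D a = a * b - b * a"
    and max: "maximal_in Q P"
    and cent: "\<And>z p. z \<in> center \<Longrightarrow> p \<in> P \<Longrightarrow> l z p - r p z \<in> Q"
    and \<delta>: "derivation \<delta>" "range \<delta> \<subseteq> P"
  shows "\<exists>p\<in>P. \<forall>a. \<delta> a - (l a p - r p a) \<in> Q"
proof -
  have Q: "subbimodule Q" and P: "subbimodule P" and QP: "Q \<subseteq> P"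
    using max by (auto simp: maximal_in_def)
  note Ps = subbimoduleD[OF P] and Qs = subbimoduleD[OF Q]
  obtain m0 where m0: "m0 \<in> P" "m0 \<notin> Q" using max by (auto simp: maximal_in_def)
  have "r m0 z - l z m0 \<in> Q" if "z \<in> center" for z
    using Qs(5)[OF cent[OF that m0(1)]] by simp
  then obtain u where u: "mact u m0 \<notin> Q" "\<And>a. l a (mact u m0) - r (mact u m0) a \<in> Q"
    using ex_central_element[OF Q _ m0(2)] Ps(1)[OF m0(1)] by blast
  define m where "m = mact u m0"
  have mP: "m \<in> P" using m0(1) P by (simp add: m_def subbimodule_mact)
  then have mC: "m \<in> C" by (rule Ps(1))
  have mQ: "m \<notin> Q" and comm: "\<And>a. l a m - r m a \<in> Q" using u by (auto simp: m_def)
  \<comment> \<open>Modulo \<open>Q\<close>, sending \<open>a\<close> to \<open>l a m\<close> is a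
    bimodule homomorphism: injective by simplicity of \<open>A\<close>, and onto
    \<open>P / Q\<close> by maximality of \<open>Q\<close>.\<close>
  have lr: "l (a * x) m - r (l a m) x \<in> Q" for a x
    using Qs(6)[OF comm[of x], of a] mC by (simp add: l_diff l_mult r_l)
  let ?I = "{a. l a m \<in> Q}"
  have "two_sided_ideal ?I"
    unfolding two_sided_ideal_def
  proof (intro conjI subspaceI ballI allI)
    fix a x assume "a \<in> ?I"
    then have a: "l a m \<in> Q" by simp
    then show "x * a \<in> ?I" using Qs(6) by (simp add: l_mult mC)
    show "a * x \<in> ?I" using Qs(3)[OF lr[of a x] Qs(7)[OF a, of x]] by simp
  qed (auto simp: mC Qs l_add_left l_scale_left)
  moreover have "1 \<notin> ?I" using mC mQ by (simp add: l_one)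
  ultimately have "?I = {0}" using two_sided_ideal_trivial[of ?I] by blast
  then have inj: "a = b" if "l a m - l b m \<in> Q" for a b
    using that l_diff_left[OF mC, of a b] by (metis (mono_tags, lifting) eq_iff_diff_eq_0 mem_Collect_eq singletonD)
  define R where "R = {x. \<exists>a. x - l a m \<in> Q}"
  have RI: "x \<in> R" if "x - l a m \<in> Q" for x a using that by (auto simp: R_def)
  have RE: "\<exists>a. x - l a m \<in> Q" if "x \<in> R" for x using that by (simp add: R_def)
  have "subbimodule R"
    unfolding subbimodule_def
  proof (intro conjI allI ballI M.subspaceI)
    show "R \<subseteq> C"
    proof
      fix x assume "x \<in> R"
      then obtain a where "x - l a m \<in> Q" using RE by blast
      then have "x - l a m + l a m \<in> C" by (intro C_intros Qs(1) mC)
      then show "x \<in> C" by simp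
    qed
    show "0 \<in> R" by (rule RI[of _ 0]) (simp add: mC Qs)
  next
    fix x y assume "x \<in> R" "y \<in> R"
    then obtain a b where "x - l a m \<in> Q" "y - l b m \<in> Q" using RE by metis
    then have "x - l a m + (y - l b m) \<in> Q" by (rule Qs(3))
    then show "x + y \<in> R" by (intro RI[of _ "a + b"]) (simp add: mC l_add_left algebra_simps)
  next
    fix c x assume "x \<in> R"
    then obtain a where "x - l a m \<in> Q" using RE by metis
    then have "s c (x - l a m) \<in> Q" by (rule Qs(8))
    then show "s c x \<in> R"
      by (intro RI[of _ "scale c a"]) (simp add: mC l_scale_left M.scale_right_diff_distrib)
  next
    fix b x assume "x \<in> R"
    then obtain a where "x - l a m \<in> Q" using RE by blast
    then obtain q where x: "x = l a m + q" "q \<in> Q" by (metis add.commute diff_add_cancel)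
    then have qC: "q \<in> C" using Qs(1) by blast
    show "l b x \<in> R" using x Qs(6)[OF x(2), of b]
      by (intro RI[of _ "b * a"]) (simp add: mC qC l_add l_mult)
    have "r q b - (l (a * b) m - r (l a m) b) \<in> Q" by (intro Qs(4,7) lr x(2))
    then show "r x b \<in> R" using x
      by (intro RI[of _ "a * b"]) (simp add: mC qC r_add algebra_simps)
  qed
  moreover have "Q \<subseteq> R" using RI[of _ 0] mC by auto
  moreover have "R \<subseteq> P"
  proof
    fix x assume "x \<in> R"
    then obtain a where "x - l a m \<in> Q" using RE by blast
    then have "x - l a m + l a m \<in> P" using QP by (intro Ps(3,6) mP) blast
    then show "x \<in> P" by simp
  qed
  moreover have "m \<in> R" by (rule RI[of _ 1]) (simp add: mC l_one Qs)
  ultimately have RP: "R = P" using mQ by (rule maximal_inD[OF max])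
  have "\<delta> a \<in> R" for a unfolding RP using \<delta>(2) by blast
  \<comment> \<open>Read through this isomorphism, \<open>\<delta>\<close> becomes a derivation
    \<open>D\<close> of \<open>A\<close>.\<close>
  then have "\<forall>a. \<exists>d. \<delta> a - l d m \<in> Q" using RE by metis
  then obtain D where D: "\<And>a. \<delta> a - l (D a) m \<in> Q" by metis
  have \<delta>C: "\<delta> a \<in> C" for a using \<delta>(2) Ps(1) by blast
  have D_eqI: "D a = d" if "\<delta> a - l d m \<in> Q" for a d
    using Qs(4)[OF that D[of a]] by (intro inj) simp
  have "Vector_Spaces.linear scale scale D"
  proof unfold_locales
    fix a b c
    show "D (a + b) = D a + D b"
      using Qs(3)[OF D[of a] D[of b]] \<delta>(1)
      by (intro D_eqI) (simp add: derivation_def l_add_left mC algebra_simps)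
    show "D (scale c a) = scale c (D a)"
      using Qs(8)[OF D[of a], of c] \<delta>(1)
      by (intro D_eqI) (simp add: derivation_def l_scale_left mC M.scale_right_diff_distrib)
  qed
  moreover have "D (a * b) = a * D b + D a * b" for a b
  proof (rule D_eqI)
    have "l a (\<delta> b - l (D b) m) + r (\<delta> a - l (D a) m) b - (l (D a * b) m - r (l (D a) m) b) \<in> Q"
      by (intro Qs(3,4,6,7) D lr)
    then show "\<delta> (a * b) - l (a * D b + D a * b) m \<in> Q"
      using \<delta>(1) \<delta>C mC by (simp add: derivation_def l_add_left l_diff r_diff l_mult algebra_simps)
  qed
  ultimately obtain b where b: "\<And>a. D a = a * b - b * a" using inner by blast
  have "\<delta> a - (l a (l b m) - r (l b m) a) \<in> Q" for a
  proof -
    have "\<delta> a - l (D a) m - (l (b * a) m - r (l b m) a) \<in> Q"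
      by (intro Qs(4) D lr)
    then show ?thesis using mC by (simp add: b l_diff_left l_mult algebra_simps)
  qed
  then show ?thesis using mP Ps(6) by blast
qed

text \<open>Induction on the dimension of \<open>P\<close>: \<open>\<delta>\<close> is inner modulo
  a maximal \<open>Q\<close>, and subtracting that inner derivation leaves one with values in
  \<open>Q\<close>.\<close>

lemma derivation_inner:
  assumes inner: "\<And>D. Vector_Spaces.linear scale scale D \<Longrightarrow> (\<And>a b. D (a * b) = a * D b + D a * b) \<Longrightarrow>
      \<exists>b. \<forall>a. D a = a * b - b * a"
    and P: "subbimodule P" "P \<subseteq> M.span S" "finite S"
    and \<delta>: "derivation \<delta>" "range \<delta> \<subseteq> P"
  shows "\<exists>p\<in>P. \<forall>a. \<delta> a = l a p - r p a"
  using P \<delta>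
proof (induction "M.dim P" arbitrary: P \<delta> rule: less_induct)
  case less
  note Ps = subbimoduleD[OF less.prems(1)]
  show ?case
  proof (cases "P = {0}")
    case True
    then show ?thesis using less.prems(5) by auto
  next
    case False
    then obtain Q where max: "maximal_in Q P" using ex_maximal_in less.prems(1-3) by blast
    then have Q: "subbimodule Q" "Q \<subset> P" by (auto simp: maximal_in_def)
    have "\<exists>p\<in>P. \<forall>a. \<delta> a - (l a p - r p a) \<in> Q"
    proof (cases "\<exists>z p. z \<in> center \<and> p \<in> P \<and> l z p - r p z \<notin> Q")
      case True
      then show ?thesis using inner_mod_of_noncentral[OF max] less.prems(4,5) by blast
    next
      case False
      then show ?thesis using inner_mod_of_central[OF inner max] less.prems(4,5) by blast
    qed
    then obtain p where p: "p \<in> P" "\<And>a. \<delta> a - (l a p - r p a) \<in> Q" by blast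
    have pC: "p \<in> C" using p(1) Ps(1) by blast
    have "\<exists>q\<in>Q. \<forall>a. \<delta> a - (l a p - r p a) = l a q - r q a"
    proof (rule less.hyps)
      show "M.dim Q < M.dim P"
        using M.dim_less_of_psubset[OF _ Q(2) less.prems(2,3)] Q(1) by (simp add: subbimodule_def)
      show "derivation (\<lambda>a. \<delta> a - (l a p - r p a))"
        using less.prems(4,5) Ps(1) pC by (intro derivation_diff_inner) auto
    qed (use Q p less.prems in auto)
    then obtain q where q: "q \<in> Q" "\<And>a. \<delta> a - (l a p - r p a) = l a q - r q a" by blast
    have "q \<in> C" using subbimoduleD(1)[OF Q(1) q(1)] .
    then have "\<delta> a = l a (p + q) - r (p + q) a" for a
      using q(2)[of a] pC by (simp add: l_add r_add algebra_simps)
    moreover have "p + q \<in> P" using p(1) q(1) Q(2) Ps(3) by blast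
    ultimately show ?thesis by blast
  qed
qed

end

section \<open>Separability from inner derivations\<close>

context unital_algebra
begin

text \<open>Equality of cosets, stated on representatives so that tensor manipulations chain
  transitively.\<close>

definition tensor_congruent :: "('a \<times> 'a \<Rightarrow>\<^sub>0 'f) \<Rightarrow> ('a \<times> 'a \<Rightarrow>\<^sub>0 'f) \<Rightarrow> bool" where
  "tensor_congruent u v \<longleftrightarrow> u - v \<in> free.span tensor_relations"

lemma tensor_congruent_refl: "tensor_congruent u u"
  by (simp add: tensor_congruent_def free.span_zero)

lemma tensor_congruent_sym: "tensor_congruent u v \<Longrightarrow> tensor_congruent v u"
  unfolding tensor_congruent_def by (metis free.span_neg minus_diff_eq)

lemma tensor_congruent_trans [trans]:
  "tensor_congruent u v \<Longrightarrow> tensor_congruent v w \<Longrightarrow> tensor_congruent u w"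
  unfolding tensor_congruent_def using free.span_add[of "u - v" _ "v - w"] by simp

lemma tensor_congruent_add:
  "tensor_congruent u v \<Longrightarrow> tensor_congruent u' v' \<Longrightarrow> tensor_congruent (u + u') (v + v')"
  unfolding tensor_congruent_def using free.span_add[of "u - v" _ "u' - v'"] by (simp add: algebra_simps)

lemma tensor_congruent_sum:
  "(\<And>i. i \<in> I \<Longrightarrow> tensor_congruent (f i) (g i)) \<Longrightarrow> tensor_congruent (sum f I) (sum g I)"
  by (induction I rule: infinite_finite_induct) (auto intro: tensor_congruent_refl tensor_congruent_add)

lemma tensor_congruent_add_left:
  "tensor_congruent (Poly_Mapping.single (x + x', y) 1)
     (Poly_Mapping.single (x, y) 1 + Poly_Mapping.single (x', y) 1)"
  unfolding tensor_congruent_def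
  unfolding diff_diff_eq[symmetric] tensor_relations_def
  by (rule free.span_base) blast

lemma tensor_congruent_add_right:
  "tensor_congruent (Poly_Mapping.single (x, y + y') 1)
     (Poly_Mapping.single (x, y) 1 + Poly_Mapping.single (x, y') 1)"
  unfolding tensor_congruent_def
  unfolding diff_diff_eq[symmetric] tensor_relations_def
  by (rule free.span_base) blast

lemma tensor_congruent_scale_left:
  "tensor_congruent (Poly_Mapping.single (scale c x, y) 1) (free_scale c (Poly_Mapping.single (x, y) 1))"
  unfolding tensor_congruent_def tensor_relations_def by (rule free.span_base) blast

lemma tensor_congruent_scale_right:
  "tensor_congruent (Poly_Mapping.single (x, scale c y) 1) (free_scale c (Poly_Mapping.single (x, y) 1))"
  unfolding tensor_congruent_def tensor_relations_def by (rule free.span_base) blast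

lemma tensor_congruent_scale:
  "tensor_congruent (Poly_Mapping.single (scale c x, y) 1) (Poly_Mapping.single (x, scale c y) 1)"
  using tensor_congruent_scale_left tensor_congruent_scale_right
  by (blast intro: tensor_congruent_trans tensor_congruent_sym)

lemma tensor_congruent_sum_left:
  "finite I \<Longrightarrow> tensor_congruent (Poly_Mapping.single (\<Sum>i\<in>I. x i, y) 1)
     (\<Sum>i\<in>I. Poly_Mapping.single (x i, y) 1)"
proof (induction I rule: finite_induct)
  case empty
  \<comment> \<open>A generator with a zero entry is not zero in the free space, but scaling by 0
    makes it congruent to zero.\<close>
  show ?case using tensor_congruent_scale_left[of 0 0 y] by simp
next
  case (insert i I)
  then show ?case
    by (auto intro: tensor_congruent_trans[OF tensor_congruent_add_left] tensor_congruent_add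
        tensor_congruent_refl)
qed

lemma tensor_congruent_sum_right:
  "finite I \<Longrightarrow> tensor_congruent (Poly_Mapping.single (x, \<Sum>i\<in>I. y i) 1)
     (\<Sum>i\<in>I. Poly_Mapping.single (x, y i) 1)"
proof (induction I rule: finite_induct)
  case empty
  show ?case using tensor_congruent_scale_right[of x 0 0] by simp
next
  case (insert i I)
  then show ?case
    by (auto intro: tensor_congruent_trans[OF tensor_congruent_add_right] tensor_congruent_add
        tensor_congruent_refl)
qed

end

lemma sum_fun_apply: "(\<Sum>i\<in>I. f i) x = (\<Sum>i\<in>I. f i x)"
  by (induction I rule: infinite_finite_induct) auto

context finite_simple_algebra
begin

text \<open>Von Neumann regularity gives \<open>y = e y\<close> with \<open>e = y z\<close>, so that \<open>x y = 0\<close> forces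
  \<open>x e = 0\<close> and the Leibniz rule for \<open>x e\<close> moves the derivation from \<open>x\<close> to \<open>e\<close>.\<close>

lemma derivation_inner_of_two_sided_zero_product_determined:
  assumes zpd: two_sided_zero_product_determined
    and lin: "Vector_Spaces.linear scale scale D"
    and leibniz: "\<And>a b. D (a * b) = a * D b + D a * b"
  shows "\<exists>b. \<forall>a. D a = a * b - b * a"
proof -
  obtain t where t: "trace_functional t" using ex_trace_functional by blast
  have t_lin: "t (x + y) = t x + t y" "t (scale c x) = c * t x" for x y c
    using t by (simp_all add: trace_functional_def linear_functional_iff)
  have t_comm: "t (x * y) = t (y * x)" for x y
    using t by (simp add: trace_functional_def)
  interpret T: Vector_Spaces.linear scale "(*)" t using t by (simp add: trace_functional_def)
  interpret D: Vector_Spaces.linear scale scale D by (rule lin)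
  have "bilinear_functional (\<lambda>x y. t (D x * y))"
    by (auto simp: bilinear_functional_def linear_functional_iff t_lin D.add D.scale algebra_simps
        scale_mult_left scale_mult_right)
  moreover have "t (D x * y) = 0" if "x * y = 0" "y * x = 0" for x y
  proof -
    obtain z where z: "y * z * y = y" using von_neumann_regular by blast
    have "D (x * (y * z)) = 0" using that(1) by (simp add: mult.assoc[symmetric])
    then have "D x * (y * z) = - (x * D (y * z))"
      by (simp add: leibniz[of x] eq_neg_iff_add_eq_0 add.commute)
    then have "D x * y = - (x * D (y * z) * y)"
      using z by (metis mult.assoc mult_minus_left)
    moreover have "t (x * D (y * z) * y) = t (y * x * D (y * z))"
      using t_comm[of "x * D (y * z)" y] by (simp add: mult.assoc)
    ultimately show ?thesis using that(2) by (simp add: T.neg)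
  qed
  ultimately obtain \<tau>\<^sub>1 \<tau>\<^sub>2 where \<tau>\<^sub>1: "Vector_Spaces.linear scale (*) \<tau>\<^sub>1"
    and \<phi>: "\<And>x y. t (D x * y) = \<tau>\<^sub>1 (x * y) + \<tau>\<^sub>2 (y * x)"
    using zpd unfolding two_sided_zero_product_determined_def by blast
  interpret \<tau>\<^sub>1: Vector_Spaces.linear scale "(*)" \<tau>\<^sub>1 by (rule \<tau>\<^sub>1)
  have "D 1 = 0" using leibniz[of 1 1] by simp
  then have "\<tau>\<^sub>2 y = - \<tau>\<^sub>1 y" for y using \<phi>[of 1 y] by (simp add: T.zero eq_neg_iff_add_eq_0 add.commute)
  then have \<phi>': "t (D x * y) = \<tau>\<^sub>1 (x * y) - \<tau>\<^sub>1 (y * x)" for x y using \<phi>[of x y] by simp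
  obtain n :: nat and u v where dual: "\<And>x. (\<Sum>i<n. scale (t (v i * x)) (u i)) = x"
    using ex_dual_bases[OF t] by blast
  \<comment> \<open>The dual bases yield the element \<open>b\<close> representing
    \<open>\<tau>\<^sub>1\<close> through the trace form.\<close>
  define b where "b = (\<Sum>i<n. scale (\<tau>\<^sub>1 (u i)) (v i))"
  have \<tau>b: "\<tau>\<^sub>1 x = t (b * x)" for x
  proof -
    have "t (b * x) = (\<Sum>i<n. t (v i * x) * \<tau>\<^sub>1 (u i))"
      by (simp add: b_def sum_distrib_right T.sum scale_mult_left t_lin mult.commute)
    also have "\<dots> = \<tau>\<^sub>1 (\<Sum>i<n. scale (t (v i * x)) (u i))"
      by (simp add: \<tau>\<^sub>1.sum \<tau>\<^sub>1.scale)
    finally show ?thesis by (simp add: dual)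
  qed
  have "D x = x * (- b) - (- b) * x" for x
  proof -
    have "t ((D x - (b * x - x * b)) * y) = 0" for y
      using \<phi>'[of x y] t_comm[of "b * y" x]
      by (simp add: \<tau>b left_diff_distrib T.diff mult.assoc)
    then have "D x - (b * x - x * b) = 0" using trace_nondegenerate[OF t] by blast
    then show ?thesis by simp
  qed
  then show ?thesis by blast
qed

text \<open>In dual bases, left multiplication on \<open>u\<close> and right multiplication on
  \<open>v\<close> have transposed matrices, so the Casimir tensor of \<open>u\<close> and
  \<open>v\<close> commutes with \<open>A\<close>. Replacing \<open>u i\<close> by
  \<open>u i * c\<close> keeps this and normalises the product.\<close>

lemma separable_of_casimir:
  fixes n :: nat
  assumes t: "trace_functional t"
    and dual: "\<And>x. (\<Sum>i<n. scale (t (v i * x)) (u i)) = x" "\<And>x. (\<Sum>i<n. scale (t (x * u i)) (v i)) = x"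
    and c: "(\<Sum>i<n. u i * c * v i) = 1"
  shows separable
  unfolding separable_def
proof (intro exI conjI allI)
  show "(\<Sum>i<n. (u i * c) * v i) = 1" by (rule c)
  fix a
  define k where "k j i = t (v j * a * u i)" for i j
  have 1: "a * (u i * c) = (\<Sum>j<n. scale (k j i) (u j * c))" for i
  proof -
    have "a * (u i * c) = (\<Sum>j<n. scale (t (v j * (a * u i))) (u j)) * c"
      by (simp only: dual mult.assoc)
    then show ?thesis by (simp add: sum_distrib_right scale_mult_left k_def mult.assoc)
  qed
  have 2: "v j * a = (\<Sum>i<n. scale (k j i) (v i))" for j
    by (simp add: k_def dual)
  let ?T = "\<lambda>x y. Poly_Mapping.single (x, y) (1 :: 'f)"
  have "tensor_congruent (\<Sum>i<n. ?T (a * (u i * c)) (v i)) (\<Sum>i<n. \<Sum>j<n. ?T (scale (k j i) (u j * c)) (v i))"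
    unfolding 1 by (intro tensor_congruent_sum tensor_congruent_sum_left) simp
  also have "tensor_congruent \<dots> (\<Sum>i<n. \<Sum>j<n. ?T (u j * c) (scale (k j i) (v i)))"
    by (intro tensor_congruent_sum tensor_congruent_scale)
  also have "(\<Sum>i<n. \<Sum>j<n. ?T (u j * c) (scale (k j i) (v i))) =
      (\<Sum>j<n. \<Sum>i<n. ?T (u j * c) (scale (k j i) (v i)))"
    by (rule sum.swap)
  also have "tensor_congruent \<dots> (\<Sum>j<n. ?T (u j * c) (v j * a))"
    unfolding 2 by (intro tensor_congruent_sum tensor_congruent_sym[OF tensor_congruent_sum_right]) simp
  finally show "tensor_sum n (\<lambda>i. a * (u i * c)) v = tensor_sum n (\<lambda>i. u i * c) (\<lambda>i. v i * a)"
    by (simp add: tensor_sum_def tensor_class_eq_iff tensor_congruent_def)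
qed

text \<open>Through \<open>x \<otimes> y \<mapsto> (\<lambda>u. t (y u) x)\<close> the bimodule \<open>A \<otimes> A\<close> becomes that of linear maps
  \<open>A \<rightarrow> A\<close>, with \<open>\<mu>\<close> below as its multiplication map and \<open>w\<close> in the role of \<open>1 \<otimes> 1\<close>.\<close>

lemma separable_of_derivations_inner:
  assumes inner: "\<And>D. Vector_Spaces.linear scale scale D \<Longrightarrow> (\<And>a b. D (a * b) = a * D b + D a * b) \<Longrightarrow>
      \<exists>b. \<forall>a. D a = a * b - b * a"
  shows separable
proof -
  obtain t where t: "trace_functional t" using ex_trace_functional by blast
  have t_lin: "t (x + y) = t x + t y" "t (scale c x) = c * t x" for x y c
    using t by (simp_all add: trace_functional_def linear_functional_iff)
  obtain n :: nat and u v where dual: "\<And>x. (\<Sum>i<n. scale (t (v i * x)) (u i)) = x"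
      "\<And>x. (\<Sum>i<n. scale (t (x * u i)) (v i)) = x"
    using ex_dual_bases[OF t] by blast
  define C where "C = {h :: 'a \<Rightarrow> 'a. Vector_Spaces.linear scale scale h}"
  define s where "s c h = (\<lambda>x. scale c (h x))" for c and h :: "'a \<Rightarrow> 'a"
  define l where "l a h = (\<lambda>x. a * h x)" for a and h :: "'a \<Rightarrow> 'a"
  define r where "r h a = (\<lambda>x. h (a * x))" for a and h :: "'a \<Rightarrow> 'a"
  interpret S: vector_space s
    by unfold_locales (auto simp: s_def fun_eq_iff algebra_simps)
  have C_iff: "h \<in> C \<longleftrightarrow> (\<forall>x y. h (x + y) = h x + h y) \<and> (\<forall>c x. h (scale c x) = scale c (h x))" for h
    using vector_space_axioms module_axioms
    by (auto simp: C_def Vector_Spaces.linear_def module_hom_def module_hom_axioms_def)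
  interpret bimod: simple_algebra_bimodule scale Basis s C l r
    by unfold_locales
      (auto simp: C_iff l_def r_def s_def fun_eq_iff scale_right_distrib
        algebra_simps scale_mult_left scale_mult_right scale_left_commute intro!: S.subspaceI)
  \<comment> \<open>\<open>h\<close> corresponds to the sum of the tensors of \<open>h (u i)\<close>
    with \<open>v i\<close>, and \<open>\<mu>\<close> multiplies their factors.\<close>
  define \<mu> where "\<mu> h = (\<Sum>i<n. h (u i) * v i)" for h :: "'a \<Rightarrow> 'a"
  have h_sum: "h (\<Sum>i<n. scale (f i) (x i)) = (\<Sum>i<n. scale (f i) (h (x i)))" if "h \<in> C" for h f x
  proof -
    interpret h: Vector_Spaces.linear scale scale h using that by (simp add: C_def)
    show ?thesis by (simp add: h.sum h.scale)
  qed
  have \<mu>_l: "\<mu> (l a h) = a * \<mu> h" for a h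
    by (simp add: \<mu>_def l_def sum_distrib_left mult.assoc)
  have \<mu>_r: "\<mu> (r h a) = \<mu> h * a" if "h \<in> C" for a h
  proof -
    have "\<mu> (r h a) = (\<Sum>i<n. h (\<Sum>j<n. scale (t (v j * (a * u i))) (u j)) * v i)"
      by (simp only: \<mu>_def r_def dual)
    also have "\<dots> = (\<Sum>i<n. \<Sum>j<n. scale (t (v j * (a * u i))) (h (u j) * v i))"
      by (simp add: h_sum[OF that] sum_distrib_right scale_mult_left)
    also have "\<dots> = (\<Sum>j<n. \<Sum>i<n. scale (t (v j * (a * u i))) (h (u j) * v i))"
      by (rule sum.swap)
    also have "\<dots> = (\<Sum>j<n. h (u j) * (\<Sum>i<n. scale (t ((v j * a) * u i)) (v i)))"
      by (simp add: sum_distrib_left scale_mult_right mult.assoc)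
    finally show ?thesis by (simp only: dual) (simp add: \<mu>_def sum_distrib_right mult.assoc)
  qed
  define P where "P = {h \<in> C. \<mu> h = 0}"
  have P: "bimod.subbimodule P"
    unfolding bimod.subbimodule_def
  proof (intro conjI allI ballI S.subspaceI)
    show "P \<subseteq> C" by (auto simp: P_def)
    show "0 \<in> P" by (simp add: P_def) (simp add: \<mu>_def)
  next
    fix x y assume "x \<in> P" "y \<in> P"
    then show "x + y \<in> P" by (auto simp: P_def) (simp add: \<mu>_def distrib_right sum.distrib)
  next
    fix c x assume "x \<in> P"
    then show "s c x \<in> P"
      by (auto simp: P_def) (simp add: \<mu>_def s_def scale_mult_left scale_sum_right[symmetric])
  qed (auto simp: P_def \<mu>_l \<mu>_r)
  \<comment> \<open>These matrix units give a finite set spanning all linear maps.\<close>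
  define E where "E i j = (\<lambda>x. scale (t (v i * x)) (u j))" for i j
  let ?S = "(\<lambda>(i, j). E i j) ` ({..<n} \<times> {..<n})"
  have "h \<in> S.span ?S" if "h \<in> C" for h
  proof -
    have "h x = (\<Sum>i<n. \<Sum>j<n. s (t (v j * h (u i))) (E i j)) x" for x
    proof -
      have "h x = (\<Sum>i<n. scale (t (v i * x)) (h (u i)))"
        using h_sum[OF that, of "\<lambda>i. t (v i * x)" u] by (simp add: dual)
      also have "\<dots> = (\<Sum>i<n. scale (t (v i * x)) (\<Sum>j<n. scale (t (v j * h (u i))) (u j)))"
        by (simp only: dual)
      also have "\<dots> = (\<Sum>i<n. \<Sum>j<n. s (t (v j * h (u i))) (E i j)) x"
        by (simp add: sum_fun_apply s_def E_def scale_sum_right mult.commute)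
      finally show ?thesis .
    qed
    then have "h = (\<Sum>i<n. \<Sum>j<n. s (t (v j * h (u i))) (E i j))" by (rule ext)
    also have "\<dots> \<in> S.span ?S"
      by (intro S.span_sum S.span_scale S.span_base) auto
    finally show ?thesis .
  qed
  then have span: "P \<subseteq> S.span ?S" by (auto simp: P_def)
  define w where "w x = scale (t x) 1" for x
  have w: "w \<in> C" by (simp add: C_iff w_def t_lin scale_left_distrib)
  have \<mu>w: "\<mu> w = 1" using dual(2)[of 1] by (simp add: \<mu>_def w_def scale_mult_left)
  \<comment> \<open>Subtracting from 0 gives the shape of \<open>derivation_diff_inner\<close>. The
    derivation is visibly inner in \<open>C\<close>; the point is to make it inner in
    \<open>P\<close>.\<close>
  have "bimod.derivation (\<lambda>a. 0 - (l a w - r w a))"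
    by (rule bimod.derivation_diff_inner) (auto simp: bimod.derivation_def w)
  moreover have "0 - (l a w - r w a) \<in> P" for a
  proof -
    have "\<mu> (0 - (l a w - r w a)) = - (\<mu> (l a w) - \<mu> (r w a))"
      by (simp add: \<mu>_def sum_subtractf[symmetric] sum_negf[symmetric] left_diff_distrib)
    also have "\<dots> = 0" using w \<mu>w by (simp add: \<mu>_l \<mu>_r)
    finally show ?thesis using w bimod.C_intros by (auto simp: P_def)
  qed
  ultimately obtain p where p: "p \<in> P" "\<And>a. 0 - (l a w - r w a) = l a p - r p a"
    using bimod.derivation_inner[OF inner P span, of "\<lambda>a. 0 - (l a w - r w a)"] by blast
  \<comment> \<open>\<open>h\<close> plays the separability idempotent: it commutes with
    \<open>A\<close> and \<open>\<mu> h = 1\<close>. Commuting makes it right multiplication by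
    \<open>h 1\<close>, the required \<open>c\<close>.\<close>
  define h where "h = w + p"
  have "l a h = r h a" for a
    using p w by (simp add: h_def P_def bimod.l_add bimod.r_add algebra_simps)
  then have "h (a * x) = a * h x" for a x
    by (simp add: l_def r_def fun_eq_iff)
  from this[of _ 1] have h1: "x * h 1 = h x" for x by (metis mult.right_neutral)
  have "\<mu> h = 1" using p(1) \<mu>w by (simp add: h_def P_def \<mu>_def distrib_right sum.distrib)
  then have "(\<Sum>i<n. u i * h 1 * v i) = 1" by (simp only: \<mu>_def h1)
  then show ?thesis by (rule separable_of_casimir[OF t dual])
qed

end

theorem theorem4p1:
  fixes scale :: "'f::field \<Rightarrow> 'a::ring_1 \<Rightarrow> 'a"
  assumes "finite_dimensional_algebra scale"
    and "simple_algebra scale"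
    and "\<not> division_algebra scale"
  shows "unital_algebra.two_sided_zero_product_determined scale \<longleftrightarrow> unital_algebra.separable scale"
proof -
  obtain Basis where "finite_dimensional_vector_space scale Basis"
    using assms(1) finite_dimensional_algebra.finite_dimensional by blast
  then interpret finite_simple_algebra scale Basis
    using assms(2) by (simp add: finite_simple_algebra_def)
  show ?thesis
  proof
    assume two_sided_zero_product_determined
    then show separable
      by (intro separable_of_derivations_inner derivation_inner_of_two_sided_zero_product_determined)
  next
    assume separable
    then show two_sided_zero_product_determined
      unfolding two_sided_zero_product_determined_def
      using representation_of_separable two_sided_zero_product_identity[OF assms(3)] by meson
  qed
qed

end
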